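(* Let $[\mathbf{G},\mathbf{o}]$ be a random rooted network with distribution $\mathcal{P}_0$ on $\mathcal{G}_*$, and let $f$ be a vertex-shift that is almost surely $1$-periodic on $[\mathbf{G},\mathbf{o}]$. Let $[\bar{\mathbf{G}},\bar{\mathbf{o}}]=\lim_{n\to\infty}[\mathbf{G},f^n(\mathbf{o})]$ (which exists almost surely). Then the $f$-probability $\mathcal{P}_0^f$ of $\mathcal{P}_0$ exists, and $\mathcal{P}_0^f$ is the distribution of $[\bar{\mathbf{G}},\bar{\mathbf{o}}]$. If in addition $[\mathbf{G},\mathbf{o}]$ is unimodular, then $\mathcal{P}_0^f$ is absolutely continuous with respect to $\mathcal{P}_0$; the limit $d_\infty(o)=\lim_{n\to\infty}d_n(o)$ exists and is finite for $\mathcal{P}_0^f$-almost every $[G,o]$; and $$\frac{d\mathcal{P}_0^f}{d\mathcal{P}_0}([G,o])=d_\infty(o)\,\mathbf{1}\{o\text{ is a trap}\}.$$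
   Context: **Networks.** A network is a connected, locally finite graph $G$ whose vertices, and whose pairs (edge, endpoint), carry marks in $\mathbb{Z}$. $\mathcal{G}_*$ (resp. $\mathcal{G}_{**}$) is the Polish space of isomorphism classes of rooted (resp. doubly rooted) networks with the local topology (convergence means that balls of each radius around the root(s) are eventually isomorphic as marked rooted graphs). A random rooted network $[\mathbf{G},\mathbf{o}]$ is unimodular if $\mathbb{E}\big[\sum_{u\in V(\mathbf{G})}g([\mathbf{G},\mathbf{o},u])\big]=\mathbb{E}\big[\sum_{u\in V(\mathbf{G})}g([\mathbf{G},u,\mathbf{o}])\big]$ for all measurable $g:\mathcal{G}_{**}\to\mathbb{R}_{\ge0}$. **Vertex-shift.** A vertex-shift is a collection $f=(f_G)$ of maps $f_G:V(G)\to V(G)$ indexed by networks such that $f_H\circ\sigma=\sigma\circ f_G$ for each network isomorphism $\sigma:G\to H$, and $[G,u,v]\mapsto\mathbf{1}_{\{f_G(u)=v\}}$ is measurable on $\mathcal{G}_{**}$. The $f$-probability of $\mathcal{P}_0$ is the weak limit, as $n\to\infty$, of the distributions of $[\mathbf{G},f^n(\mathbf{o})]$, if it exists. **$1$-periodic, traps, $d_n$.** $f$ is a.s. $1$-periodic on $[\mathbf{G},\mathbf{o}]$ if for $\mathcal{P}_0$-almost every $[G,o]$ there is $k=k(o)$ such that $f_G^{n+1}(o)=f_G^n(o)$ for all $n\ge k$. A vertex $o$ of $G$ is a trap if $f_G(o)=o$. $d_n(o)=\#\{v\in V(G): f_G^n(v)=o\}$. *)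

theory Defs
  imports "HOL-Probability.Probability"
begin

section \<open>Networks\<close>

text \<open>
  Connected locally finite graphs are countable, so up to isomorphism every network has its vertices
  and edges in \<^typ>\<open>nat\<close>. Multiple edges and loops are allowed; a loop has a single endpoint.
  Values of the functions outside \<open>verts\<close> and \<open>edges\<close> are irrelevant: isomorphisms ignore them.
\<close>

record multigraph =
  verts :: "nat set"
  edges :: "nat set"
  ends  :: "nat \<Rightarrow> nat set"
  vmark :: "nat \<Rightarrow> int"
  emark :: "nat \<Rightarrow> nat \<Rightarrow> int"  \<comment> \<open>\<open>emark G e v\<close> is the mark of the pair \<open>(e, v)\<close>, for \<open>v \<in> ends G e\<close>\<close>

definition adj :: "multigraph \<Rightarrow> (nat \<times> nat) set" where
  "adj G = {(u, v). \<exists>e \<in> edges G. ends G e = {u, v}}"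

definition network :: "multigraph \<Rightarrow> bool" where
  "network G \<longleftrightarrow>
     verts G \<noteq> {} \<and>
     (\<forall>e \<in> edges G. ends G e \<subseteq> verts G \<and> card (ends G e) \<in> {1, 2}) \<and>
     (\<forall>v \<in> verts G. finite {e \<in> edges G. v \<in> ends G e}) \<and>
     (\<forall>u \<in> verts G. \<forall>v \<in> verts G. (u, v) \<in> (adj G)\<^sup>*)"

definition graph_iso :: "(nat \<Rightarrow> nat) \<Rightarrow> (nat \<Rightarrow> nat) \<Rightarrow> multigraph \<Rightarrow> multigraph \<Rightarrow> bool" where
  "graph_iso \<sigma> \<tau> G H \<longleftrightarrow>
     bij_betw \<sigma> (verts G) (verts H) \<and> bij_betw \<tau> (edges G) (edges H) \<and>
     (\<forall>e \<in> edges G. ends H (\<tau> e) = \<sigma> ` ends G e) \<and>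
     (\<forall>v \<in> verts G. vmark H (\<sigma> v) = vmark G v) \<and>
     (\<forall>e \<in> edges G. \<forall>v \<in> ends G e. emark H (\<tau> e) (\<sigma> v) = emark G e v)"

definition rooted_iso :: "multigraph \<Rightarrow> nat list \<Rightarrow> multigraph \<Rightarrow> nat list \<Rightarrow> bool" where
  "rooted_iso G os H ps \<longleftrightarrow> (\<exists>\<sigma> \<tau>. graph_iso \<sigma> \<tau> G H \<and> map \<sigma> os = ps)"

definition ball_verts :: "multigraph \<Rightarrow> nat list \<Rightarrow> nat \<Rightarrow> nat set" where
  "ball_verts G os r = {v \<in> verts G. \<exists>u \<in> set os. \<exists>k \<le> r. (u, v) \<in> adj G ^^ k}"

definition net_ball :: "multigraph \<Rightarrow> nat list \<Rightarrow> nat \<Rightarrow> multigraph" where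
  "net_ball G os r =
     G\<lparr>verts := ball_verts G os r, edges := {e \<in> edges G. ends G e \<subseteq> ball_verts G os r}\<rparr>"

definition balls_iso :: "nat \<Rightarrow> multigraph \<Rightarrow> nat list \<Rightarrow> multigraph \<Rightarrow> nat list \<Rightarrow> bool" where
  "balls_iso r G os H ps \<longleftrightarrow> rooted_iso (net_ball G os r) os (net_ball H ps r) ps"

lemma graph_iso_id: "graph_iso id id G G"
  by (simp add: graph_iso_def)

lemma graph_iso_sym:
  assumes G: "\<forall>e \<in> edges G. ends G e \<subseteq> verts G" and iso: "graph_iso \<sigma> \<tau> G H"
  shows "graph_iso (inv_into (verts G) \<sigma>) (inv_into (edges G) \<tau>) H G"
proof -
  let ?s = "inv_into (verts G) \<sigma>" and ?t = "inv_into (edges G) \<tau>"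
  have bs: "bij_betw \<sigma> (verts G) (verts H)" and bt: "bij_betw \<tau> (edges G) (edges H)"
    using iso by (auto simp: graph_iso_def)
  have s: "?s (\<sigma> v) = v" if "v \<in> verts G" for v
    using bs that by (simp add: bij_betw_inv_into_left)
  have t: "?t (\<tau> e) = e" if "e \<in> edges G" for e
    using bt that by (simp add: bij_betw_inv_into_left)
  have img: "?s ` \<sigma> ` A = A" if "A \<subseteq> verts G" for A
    using s that by (force simp: image_iff)
  have HE: "\<exists>e'. e' \<in> edges G \<and> e = \<tau> e'" if "e \<in> edges H" for e
    using bt that by (auto simp: bij_betw_def)
  have HV: "\<exists>v'. v' \<in> verts G \<and> v = \<sigma> v'" if "v \<in> verts H" for v
    using bs that by (auto simp: bij_betw_def)
  show ?thesis
    unfolding graph_iso_def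
  proof (intro conjI ballI)
    show "bij_betw ?s (verts H) (verts G)" "bij_betw ?t (edges H) (edges G)"
      using bs bt by (simp_all add: bij_betw_inv_into)
  next
    fix e assume "e \<in> edges H"
    then obtain e' where "e' \<in> edges G" "e = \<tau> e'" using HE by blast
    then show "ends G (?t e) = ?s ` ends H e"
      using iso img G t by (simp add: graph_iso_def)
  next
    fix v assume "v \<in> verts H"
    then obtain v' where "v' \<in> verts G" "v = \<sigma> v'" using HV by blast
    then show "vmark G (?s v) = vmark H v"
      using iso s by (simp add: graph_iso_def)
  next
    fix e v assume "e \<in> edges H" and v: "v \<in> ends H e"
    then obtain e' where e': "e' \<in> edges G" "e = \<tau> e'" using HE by blast
    then have "ends H e = \<sigma> ` ends G e'" using iso by (simp add: graph_iso_def)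
    then obtain v' where v': "v' \<in> ends G e'" "v = \<sigma> v'" using v by auto
    then have "v' \<in> verts G" using G e' by blast
    then show "emark G (?t e) (?s v) = emark H e v"
      using iso s t e' v' by (simp add: graph_iso_def)
  qed
qed

lemma graph_iso_trans:
  assumes "graph_iso \<sigma> \<tau> G H" "graph_iso \<sigma>' \<tau>' H K"
  shows "graph_iso (\<sigma>' \<circ> \<sigma>) (\<tau>' \<circ> \<tau>) G K"
proof -
  have "\<tau> e \<in> edges H" if "e \<in> edges G" for e
    using assms(1) that by (auto simp: graph_iso_def bij_betw_def)
  moreover have "\<sigma> v \<in> verts H" if "v \<in> verts G" for v
    using assms(1) that by (auto simp: graph_iso_def bij_betw_def)
  ultimately show ?thesis
    using assms by (auto simp: graph_iso_def image_comp intro: bij_betw_trans)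
qed

lemma rooted_iso_refl: "rooted_iso G os G os"
  unfolding rooted_iso_def by (metis graph_iso_id list.map_id)

lemma rooted_iso_sym:
  assumes "\<forall>e \<in> edges G. ends G e \<subseteq> verts G" "set os \<subseteq> verts G" "rooted_iso G os H ps"
  shows "rooted_iso H ps G os"
proof -
  obtain \<sigma> \<tau> where iso: "graph_iso \<sigma> \<tau> G H" and ps: "ps = map \<sigma> os"
    using assms(3) unfolding rooted_iso_def by blast
  have "map (inv_into (verts G) \<sigma>) ps = os"
    using iso assms(2) unfolding ps map_map
    by (intro map_idI) (auto simp: graph_iso_def bij_betw_inv_into_left)
  then show ?thesis
    using graph_iso_sym[OF assms(1) iso] unfolding rooted_iso_def by blast
qed

lemma rooted_iso_trans:
  assumes "rooted_iso G os H ps" "rooted_iso H ps K qs"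
  shows "rooted_iso G os K qs"
  using assms unfolding rooted_iso_def by (metis graph_iso_trans list.map_comp)

lemma rooted_iso_imp_balls_iso:
  assumes G: "network G" and os: "set os \<subseteq> verts G" and iso: "rooted_iso G os H ps"
  shows "balls_iso r G os H ps"
proof -
  have half: "\<sigma> ` ball_verts G os r \<subseteq> ball_verts H (map \<sigma> os) r"
    if iso: "graph_iso \<sigma> \<tau> G H" for \<sigma> \<tau> G H os
  proof -
    have bs: "\<sigma> ` verts G = verts H" using iso by (simp add: graph_iso_def bij_betw_def)
    have bt: "\<tau> ` edges G = edges H" using iso by (simp add: graph_iso_def bij_betw_def)
    have adj: "(\<sigma> u, \<sigma> v) \<in> adj H" if "(u, v) \<in> adj G" for u v
    proof -
      obtain e where "e \<in> edges G" "ends G e = {u, v}" using \<open>(u, v) \<in> adj G\<close> by (auto simp: adj_def)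
      then have "\<tau> e \<in> edges H" "ends H (\<tau> e) = {\<sigma> u, \<sigma> v}"
        using bt iso by (auto simp: graph_iso_def)
      then show ?thesis by (auto simp: adj_def)
    qed
    have pow: "(\<sigma> u, \<sigma> v) \<in> adj H ^^ k" if "(u, v) \<in> adj G ^^ k" for u v k
      using that by (induction k arbitrary: v) (auto dest: adj)
    show ?thesis
      using bs pow by (auto simp: ball_verts_def) blast+
  qed
  obtain \<sigma> \<tau> where iso: "graph_iso \<sigma> \<tau> G H" and ps: "ps = map \<sigma> os"
    using iso unfolding rooted_iso_def by blast
  have E: "\<forall>e \<in> edges G. ends G e \<subseteq> verts G" using G by (simp add: network_def)
  let ?s = "inv_into (verts G) \<sigma>"
  have bs: "bij_betw \<sigma> (verts G) (verts H)" and bt: "bij_betw \<tau> (edges G) (edges H)"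
    using iso by (auto simp: graph_iso_def)
  have "map ?s ps = os"
    using bs os unfolding ps map_map by (intro map_idI) (auto simp: bij_betw_inv_into_left)
  then have back_sub: "?s ` ball_verts H ps r \<subseteq> ball_verts G os r"
    using half[OF graph_iso_sym[OF E iso], of ps] by simp
  have V: "\<sigma> ` ball_verts G os r = ball_verts H ps r"
  proof
    show "\<sigma> ` ball_verts G os r \<subseteq> ball_verts H ps r" using half[OF iso] ps by simp
    show "ball_verts H ps r \<subseteq> \<sigma> ` ball_verts G os r"
    proof
      fix w assume w: "w \<in> ball_verts H ps r"
      then have "\<sigma> (?s w) = w" using bs by (auto simp: ball_verts_def bij_betw_inv_into_right)
      moreover have "?s w \<in> ball_verts G os r" using back_sub w by blast
      ultimately show "w \<in> \<sigma> ` ball_verts G os r" by (metis imageI)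
    qed
  qed
  have sub: "ball_verts G os r \<subseteq> verts G" by (auto simp: ball_verts_def)
  have inj: "inj_on \<sigma> (verts G)" using bs by (simp add: bij_betw_def)
  have ends_iff: "ends H (\<tau> e) \<subseteq> ball_verts H ps r \<longleftrightarrow> ends G e \<subseteq> ball_verts G os r"
    if "e \<in> edges G" for e
  proof -
    have "ends H (\<tau> e) = \<sigma> ` ends G e" using iso that by (simp add: graph_iso_def)
    then show ?thesis
      using V inj_on_image_subset_iff[OF inj, of "ends G e" "ball_verts G os r"] E that sub by metis
  qed
  let ?EG = "{e \<in> edges G. ends G e \<subseteq> ball_verts G os r}"
  let ?EH = "{e \<in> edges H. ends H e \<subseteq> ball_verts H ps r}"
  have imgE: "\<tau> ` ?EG = ?EH"
  proof
    show "\<tau> ` ?EG \<subseteq> ?EH" using bt ends_iff by (auto simp: bij_betw_def)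
    show "?EH \<subseteq> \<tau> ` ?EG" using bt ends_iff by (fastforce simp: bij_betw_def)
  qed
  have "bij_betw \<tau> ?EG ?EH"
    using bij_betw_subset[OF bt _ imgE] by auto
  moreover have "bij_betw \<sigma> (ball_verts G os r) (ball_verts H ps r)"
    using bij_betw_subset[OF bs sub V] .
  ultimately have "graph_iso \<sigma> \<tau> (net_ball G os r) (net_ball H ps r)"
    using iso sub unfolding graph_iso_def net_ball_def by auto
  then show ?thesis
    using ps unfolding balls_iso_def rooted_iso_def by blast
qed

lemma balls_iso_refl: "balls_iso r G os G os"
  by (simp add: balls_iso_def rooted_iso_refl)

lemma balls_iso_sym:
  assumes os: "set os \<subseteq> verts G" and iso: "balls_iso r G os H ps"
  shows "balls_iso r H ps G os"
proof -
  have "set os \<subseteq> ball_verts G os r"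
  proof
    fix w assume "w \<in> set os"
    moreover have "(w, w) \<in> adj G ^^ 0" by simp
    ultimately show "w \<in> ball_verts G os r" using os unfolding ball_verts_def by blast
  qed
  then show ?thesis
    unfolding balls_iso_def
    by (intro rooted_iso_sym[OF _ _ iso[unfolded balls_iso_def]]) (auto simp: net_ball_def)
qed

lemma balls_iso_trans:
  "balls_iso r G os H ps \<Longrightarrow> balls_iso r H ps K qs \<Longrightarrow> balls_iso r G os K qs"
  unfolding balls_iso_def by (rule rooted_iso_trans)

section \<open>The spaces of rooted and doubly rooted networks\<close>

definition rooted_rel :: "multigraph \<times> nat \<Rightarrow> multigraph \<times> nat \<Rightarrow> bool" where
  "rooted_rel = (\<lambda>(G, u) (H, p).
     network G \<and> u \<in> verts G \<and> network H \<and> p \<in> verts H \<and> rooted_iso G [u] H [p])"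

definition birooted_rel :: "multigraph \<times> nat \<times> nat \<Rightarrow> multigraph \<times> nat \<times> nat \<Rightarrow> bool" where
  "birooted_rel = (\<lambda>(G, u, v) (H, p, q).
     network G \<and> u \<in> verts G \<and> v \<in> verts G \<and> network H \<and> p \<in> verts H \<and> q \<in> verts H \<and>
     rooted_iso G [u, v] H [p, q])"

lemma network_singleton:
  "network \<lparr>verts = {0}, edges = {}, ends = \<lambda>_. {}, vmark = \<lambda>_. 0, emark = \<lambda>_ _. 0\<rparr>"
  by (simp add: network_def)

lemma network_ends: "network G \<Longrightarrow> \<forall>e \<in> edges G. ends G e \<subseteq> verts G"
  by (simp add: network_def)

quotient_type rooted_network = "multigraph \<times> nat" / partial: rooted_rel
proof (rule part_equivpI)
  show "\<exists>x. rooted_rel x x"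
    using network_singleton
    by (intro exI[of _ "(\<lparr>verts = {0}, edges = {}, ends = \<lambda>_. {}, vmark = \<lambda>_. 0, emark = \<lambda>_ _. 0\<rparr>, 0)"])
      (simp add: rooted_rel_def rooted_iso_refl)
  show "symp rooted_rel"
    unfolding symp_def rooted_rel_def by (clarsimp simp: rooted_iso_sym[OF network_ends])
  show "transp rooted_rel"
    unfolding transp_def rooted_rel_def by (clarsimp, blast intro: rooted_iso_trans)
qed

quotient_type birooted_network = "multigraph \<times> nat \<times> nat" / partial: birooted_rel
proof (rule part_equivpI)
  show "\<exists>x. birooted_rel x x"
    using network_singleton
    by (intro exI[of _ "(\<lparr>verts = {0}, edges = {}, ends = \<lambda>_. {}, vmark = \<lambda>_. 0, emark = \<lambda>_ _. 0\<rparr>, 0, 0)"])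
      (simp add: birooted_rel_def rooted_iso_refl)
  show "symp birooted_rel"
    unfolding symp_def birooted_rel_def by (clarsimp simp: rooted_iso_sym[OF network_ends])
  show "transp birooted_rel"
    unfolding transp_def birooted_rel_def by (clarsimp, blast intro: rooted_iso_trans)
qed

text \<open>\<open>rooted_class G u\<close> is \<open>[G, u]\<close> and \<open>birooted_class G u v\<close> is \<open>[G, u, v]\<close>.\<close>

definition rooted_class :: "multigraph \<Rightarrow> nat \<Rightarrow> rooted_network" where
  "rooted_class G u = abs_rooted_network (G, u)"

definition birooted_class :: "multigraph \<Rightarrow> nat \<Rightarrow> nat \<Rightarrow> birooted_network" where
  "birooted_class G u v = abs_birooted_network (G, u, v)"

text \<open>An arbitrarily chosen representative \<open>(G, u)\<close> of a class \<open>[G, u]\<close>.\<close>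

definition net_of :: "rooted_network \<Rightarrow> multigraph" where
  "net_of x = fst (rep_rooted_network x)"

definition root_of :: "rooted_network \<Rightarrow> nat" where
  "root_of x = snd (rep_rooted_network x)"

lemma rep_rooted:
  "network (net_of x)" "root_of x \<in> verts (net_of x)" "rooted_class (net_of x) (root_of x) = x"
proof -
  have "rooted_rel (rep_rooted_network x) (rep_rooted_network x)"
    by (rule Quotient3_rep_reflp[OF Quotient3_rooted_network])
  then show "network (net_of x)" "root_of x \<in> verts (net_of x)"
    by (auto simp: net_of_def root_of_def rooted_rel_def split: prod.splits)
  show "rooted_class (net_of x) (root_of x) = x"
    by (simp add: rooted_class_def net_of_def root_of_def Quotient3_abs_rep[OF Quotient3_rooted_network])
qed

lemma rooted_class_eq_iff:
  assumes "network G" "u \<in> verts G" "network H" "p \<in> verts H"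
  shows "rooted_class G u = rooted_class H p \<longleftrightarrow> rooted_iso G [u] H [p]"
  using Quotient3_rel[OF Quotient3_rooted_network, of "(G, u)" "(H, p)"] assms
  by (auto simp: rooted_class_def rooted_rel_def rooted_iso_refl)

lemma birooted_class_eq_iff:
  assumes "network G" "u \<in> verts G" "v \<in> verts G" "network H" "p \<in> verts H" "q \<in> verts H"
  shows "birooted_class G u v = birooted_class H p q \<longleftrightarrow> rooted_iso G [u, v] H [p, q]"
  using Quotient3_rel[OF Quotient3_birooted_network, of "(G, u, v)" "(H, p, q)"] assms
  by (auto simp: birooted_class_def birooted_rel_def rooted_iso_refl)

lemma birooted_class_cases:
  obtains G u v where "network G" "u \<in> verts G" "v \<in> verts G" "z = birooted_class G u v"
proof -
  obtain G u v where r: "rep_birooted_network z = (G, u, v)" by (metis prod_cases3)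
  have "birooted_rel (G, u, v) (G, u, v)"
    using Quotient3_rep_reflp[OF Quotient3_birooted_network, of z] r by simp
  moreover have "z = birooted_class G u v"
    using Quotient3_abs_rep[OF Quotient3_birooted_network, of z] r by (simp add: birooted_class_def)
  ultimately show ?thesis using that by (auto simp: birooted_rel_def)
qed

definition cylinder :: "multigraph \<Rightarrow> nat \<Rightarrow> nat \<Rightarrow> rooted_network set" where
  "cylinder G u r =
     {rooted_class H p | H p. network H \<and> p \<in> verts H \<and> balls_iso r G [u] H [p]}"

definition bicylinder :: "multigraph \<Rightarrow> nat \<Rightarrow> nat \<Rightarrow> nat \<Rightarrow> birooted_network set" where
  "bicylinder G u v r =
     {birooted_class H p q | H p q.
        network H \<and> p \<in> verts H \<and> q \<in> verts H \<and> balls_iso r G [u, v] H [p, q]}"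

instantiation rooted_network :: topological_space
begin
definition open_rooted_network :: "rooted_network set \<Rightarrow> bool" where
  "open_rooted_network = generate_topology {cylinder G u r | G u r. network G \<and> u \<in> verts G}"
instance using topological_space_generate_topology
  by intro_classes (auto simp: open_rooted_network_def class.topological_space_def)
end

instantiation birooted_network :: topological_space
begin
definition open_birooted_network :: "birooted_network set \<Rightarrow> bool" where
  "open_birooted_network =
     generate_topology {bicylinder G u v r | G u v r. network G \<and> u \<in> verts G \<and> v \<in> verts G}"
instance using topological_space_generate_topology
  by intro_classes (auto simp: open_birooted_network_def class.topological_space_def)
end

lemma rooted_class_in_cylinder_iff:
  assumes "network H" "p \<in> verts H"
  shows "rooted_class H p \<in> cylinder G u r \<longleftrightarrow> balls_iso r G [u] H [p]"
proof
  assume "rooted_class H p \<in> cylinder G u r"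
  then obtain K q where K: "network K" "q \<in> verts K" "balls_iso r G [u] K [q]"
    and eq: "rooted_class H p = rooted_class K q" by (auto simp: cylinder_def)
  then have "rooted_iso K [q] H [p]"
    using assms rooted_class_eq_iff[of K q H p] by simp
  then show "balls_iso r G [u] H [p]"
    using K(2) by (intro balls_iso_trans[OF K(3)] rooted_iso_imp_balls_iso[OF K(1)]) simp_all
next
  assume "balls_iso r G [u] H [p]"
  then show "rooted_class H p \<in> cylinder G u r" unfolding cylinder_def using assms by blast
qed

lemma birooted_class_in_bicylinder_iff:
  assumes "network H" "p \<in> verts H" "q \<in> verts H"
  shows "birooted_class H p q \<in> bicylinder G u v r \<longleftrightarrow> balls_iso r G [u, v] H [p, q]"
proof
  assume "birooted_class H p q \<in> bicylinder G u v r"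
  then obtain K a b where K: "network K" "a \<in> verts K" "b \<in> verts K" "balls_iso r G [u, v] K [a, b]"
    and eq: "birooted_class H p q = birooted_class K a b" by (auto simp: bicylinder_def)
  then have "rooted_iso K [a, b] H [p, q]"
    using assms birooted_class_eq_iff[of K a b H p q] by simp
  then show "balls_iso r G [u, v] H [p, q]"
    using K(2,3) by (intro balls_iso_trans[OF K(4)] rooted_iso_imp_balls_iso[OF K(1)]) simp_all
next
  assume "balls_iso r G [u, v] H [p, q]"
  then show "birooted_class H p q \<in> bicylinder G u v r" unfolding bicylinder_def using assms by blast
qed

lemma tendsto_generate_topology:
  fixes l :: "'a::topological_space"
  assumes "open = generate_topology B"
  shows "(f \<longlongrightarrow> l) F \<longleftrightarrow> (\<forall>S \<in> B. l \<in> S \<longrightarrow> eventually (\<lambda>x. f x \<in> S) F)"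
proof
  assume "(f \<longlongrightarrow> l) F"
  moreover have "open S" if "S \<in> B" for S
    using that by (simp add: assms generate_topology.Basis)
  ultimately show "\<forall>S \<in> B. l \<in> S \<longrightarrow> eventually (\<lambda>x. f x \<in> S) F"
    by (simp add: tendsto_def)
next
  assume B: "\<forall>S \<in> B. l \<in> S \<longrightarrow> eventually (\<lambda>x. f x \<in> S) F"
  show "(f \<longlongrightarrow> l) F"
    unfolding tendsto_def
  proof (intro allI impI)
    fix S assume "open S" "l \<in> S"
    then have "generate_topology B S" by (simp only: assms)
    then show "eventually (\<lambda>x. f x \<in> S) F"
      using \<open>l \<in> S\<close>
    proof induction
      case UNIV
      show ?case by simp
    next
      case (Int a b)
      then show ?case by (simp add: eventually_conj)
    next
      case (UN K)
      then obtain k where k: "k \<in> K" "l \<in> k" by blast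
      then have "eventually (\<lambda>x. f x \<in> k) F" by (rule UN.IH)
      then show ?case by (rule eventually_mono) (use k in blast)
    next
      case (Basis s)
      then show ?case using B by blast
    qed
  qed
qed

lemma tendsto_rooted_class_iff:
  assumes "network G" "u \<in> verts G" "\<And>n. network (H n)" "\<And>n. p n \<in> verts (H n)"
  shows "((\<lambda>n. rooted_class (H n) (p n)) \<longlongrightarrow> rooted_class G u) F \<longleftrightarrow>
           (\<forall>r. eventually (\<lambda>n. balls_iso r G [u] (H n) [p n]) F)" (is "?L \<longleftrightarrow> ?R")
proof
  assume L: ?L
  have "rooted_class G u \<in> cylinder G u r" for r
    using assms by (simp add: rooted_class_in_cylinder_iff balls_iso_refl)
  then have "eventually (\<lambda>n. rooted_class (H n) (p n) \<in> cylinder G u r) F" for r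
    using L assms unfolding tendsto_generate_topology[OF open_rooted_network_def] by blast
  then show ?R using assms by (simp add: rooted_class_in_cylinder_iff)
next
  assume R: ?R
  show ?L
    unfolding tendsto_generate_topology[OF open_rooted_network_def]
  proof clarify
    fix K q r assume K: "network K" "q \<in> verts K" "rooted_class G u \<in> cylinder K q r"
    then have "balls_iso r K [q] G [u]" using assms by (simp add: rooted_class_in_cylinder_iff)
    then have "eventually (\<lambda>n. balls_iso r K [q] (H n) [p n]) F"
      by (intro eventually_mono[OF R[rule_format, of r]]) (rule balls_iso_trans)
    then show "eventually (\<lambda>n. rooted_class (H n) (p n) \<in> cylinder K q r) F"
      using assms by (simp add: rooted_class_in_cylinder_iff)
  qed
qed

lemma tendsto_birooted_class_iff:
  assumes "network G" "u \<in> verts G" "v \<in> verts G"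
    "\<And>n. network (H n)" "\<And>n. p n \<in> verts (H n)" "\<And>n. q n \<in> verts (H n)"
  shows "((\<lambda>n. birooted_class (H n) (p n) (q n)) \<longlongrightarrow> birooted_class G u v) F \<longleftrightarrow>
           (\<forall>r. eventually (\<lambda>n. balls_iso r G [u, v] (H n) [p n, q n]) F)" (is "?L \<longleftrightarrow> ?R")
proof
  assume L: ?L
  have "birooted_class G u v \<in> bicylinder G u v r" for r
    using assms by (simp add: birooted_class_in_bicylinder_iff balls_iso_refl)
  then have "eventually (\<lambda>n. birooted_class (H n) (p n) (q n) \<in> bicylinder G u v r) F" for r
    using L assms unfolding tendsto_generate_topology[OF open_birooted_network_def] by blast
  then show ?R using assms by (simp add: birooted_class_in_bicylinder_iff)
next
  assume R: ?R
  show ?L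
    unfolding tendsto_generate_topology[OF open_birooted_network_def]
  proof clarify
    fix K a b r
    assume K: "network K" "a \<in> verts K" "b \<in> verts K" "birooted_class G u v \<in> bicylinder K a b r"
    then have "balls_iso r K [a, b] G [u, v]" using assms by (simp add: birooted_class_in_bicylinder_iff)
    then have "eventually (\<lambda>n. balls_iso r K [a, b] (H n) [p n, q n]) F"
      by (intro eventually_mono[OF R[rule_format, of r]]) (rule balls_iso_trans)
    then show "eventually (\<lambda>n. birooted_class (H n) (p n) (q n) \<in> bicylinder K a b r) F"
      using assms by (simp add: birooted_class_in_bicylinder_iff)
  qed
qed

section \<open>Unimodularity\<close>

text \<open>The sum over vertices is the integral with respect to counting measure.\<close>

definition unimodular :: "rooted_network measure \<Rightarrow> bool" where
  "unimodular P \<longleftrightarrow>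
     (\<forall>g \<in> borel_measurable borel. (\<forall>z. 0 \<le> (g z :: real)) \<longrightarrow>
        (\<integral>\<^sup>+x. (\<integral>\<^sup>+u. ennreal (g (birooted_class (net_of x) (root_of x) u))
                  \<partial>count_space (verts (net_of x))) \<partial>P) =
        (\<integral>\<^sup>+x. (\<integral>\<^sup>+u. ennreal (g (birooted_class (net_of x) u (root_of x)))
                  \<partial>count_space (verts (net_of x))) \<partial>P))"

section \<open>Vertex-shifts\<close>

definition vertex_shift :: "(multigraph \<Rightarrow> nat \<Rightarrow> nat) \<Rightarrow> bool" where
  "vertex_shift f \<longleftrightarrow>
     (\<forall>G. network G \<longrightarrow> f G \<in> verts G \<rightarrow> verts G) \<and>
     (\<forall>G H \<sigma> \<tau>. network G \<and> network H \<and> graph_iso \<sigma> \<tau> G H \<longrightarrow>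
        (\<forall>v \<in> verts G. f H (\<sigma> v) = \<sigma> (f G v))) \<and>
     {birooted_class G u v | G u v. network G \<and> u \<in> verts G \<and> v \<in> verts G \<and> f G u = v}
       \<in> sets borel"

text \<open>\<open>move_root f n [G, u] = [G, f\<^sub>G\<^sup>n(u)]\<close>\<close>

definition move_root ::
    "(multigraph \<Rightarrow> nat \<Rightarrow> nat) \<Rightarrow> nat \<Rightarrow> rooted_network \<Rightarrow> rooted_network" where
  "move_root f n x = rooted_class (net_of x) ((f (net_of x) ^^ n) (root_of x))"

definition eventually_fixed :: "(multigraph \<Rightarrow> nat \<Rightarrow> nat) \<Rightarrow> rooted_network \<Rightarrow> bool" where
  "eventually_fixed f x \<longleftrightarrow>
     (\<exists>k. \<forall>n \<ge> k. (f (net_of x) ^^ (n + 1)) (root_of x) = (f (net_of x) ^^ n) (root_of x))"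

definition one_periodic ::
    "(multigraph \<Rightarrow> nat \<Rightarrow> nat) \<Rightarrow> rooted_network measure \<Rightarrow> bool" where
  "one_periodic f P \<longleftrightarrow> (AE x in P. eventually_fixed f x)"

definition trap :: "(multigraph \<Rightarrow> nat \<Rightarrow> nat) \<Rightarrow> rooted_network \<Rightarrow> bool" where
  "trap f x \<longleftrightarrow> f (net_of x) (root_of x) = root_of x"

text \<open>\<open>d_n f n [G, u] = d\<^sub>n(u)\<close>, with value \<open>\<infinity>\<close> if there are infinitely many such vertices.\<close>

definition d_n :: "(multigraph \<Rightarrow> nat \<Rightarrow> nat) \<Rightarrow> nat \<Rightarrow> rooted_network \<Rightarrow> ennreal" where
  "d_n f n x = emeasure (count_space (verts (net_of x)))
               {v \<in> verts (net_of x). (f (net_of x) ^^ n) v = root_of x}"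

text \<open>Meaningful only where the limit exists.\<close>

definition d_infty :: "(multigraph \<Rightarrow> nat \<Rightarrow> nat) \<Rightarrow> rooted_network \<Rightarrow> ennreal" where
  "d_infty f x = lim (\<lambda>n. d_n f n x)"

definition weak_limit :: "(nat \<Rightarrow> 'a::topological_space measure) \<Rightarrow> 'a measure \<Rightarrow> bool" where
  "weak_limit \<mu> Q \<longleftrightarrow>
     (\<forall>h :: 'a \<Rightarrow> real. continuous_on UNIV h \<and> bounded (range h) \<longrightarrow>
        (\<lambda>n. \<integral>x. h x \<partial>\<mu> n) \<longlonglongrightarrow> (\<integral>x. h x \<partial>Q))"

definition has_f_probability :: "(multigraph \<Rightarrow> nat \<Rightarrow> nat) \<Rightarrow>
    rooted_network measure \<Rightarrow> rooted_network measure \<Rightarrow> bool" where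
  "has_f_probability f P Q \<longleftrightarrow>
     prob_space Q \<and> sets Q = sets borel \<and> weak_limit (\<lambda>n. distr P borel (move_root f n)) Q"

definition f_probability ::
    "(multigraph \<Rightarrow> nat \<Rightarrow> nat) \<Rightarrow> rooted_network measure \<Rightarrow> rooted_network measure" where
  "f_probability f P = (THE Q. has_f_probability f P Q)"

subsection \<open>Independence of the chosen representative\<close>

lemma vertex_shift_funpow:
  assumes f: "vertex_shift f" and G: "network G" and H: "network H" and iso: "graph_iso \<sigma> \<tau> G H"
    and v: "v \<in> verts G"
  shows "(f G ^^ n) v \<in> verts G" "(f H ^^ n) (\<sigma> v) = \<sigma> ((f G ^^ n) v)"
proof -
  have "f G \<in> verts G \<rightarrow> verts G"
    using f G by (simp add: vertex_shift_def)
  then have mem: "(f G ^^ n) v \<in> verts G" for n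
    using v by (induction n) auto
  then show "(f G ^^ n) v \<in> verts G" .
  show "(f H ^^ n) (\<sigma> v) = \<sigma> ((f G ^^ n) v)"
  proof (induction n)
    case (Suc n)
    have "\<forall>w \<in> verts G. f H (\<sigma> w) = \<sigma> (f G w)"
      using f[unfolded vertex_shift_def, THEN conjunct2, THEN conjunct1] G H iso by blast
    then show ?case using Suc mem[of n] by simp
  qed simp
qed

context
  fixes f G u
  assumes f: "vertex_shift f" and G: "network G" and u: "u \<in> verts G"
begin

lemma rep_iso:
  obtains \<sigma> \<tau> where "graph_iso \<sigma> \<tau> G (net_of (rooted_class G u))"
    "root_of (rooted_class G u) = \<sigma> u"
proof -
  let ?x = "rooted_class G u"
  have "rooted_iso G [u] (net_of ?x) [root_of ?x]"
    using rooted_class_eq_iff[OF G u rep_rooted(1,2)[of ?x]] rep_rooted(3)[of ?x] by simp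
  then show ?thesis using that by (auto simp: rooted_iso_def)
qed

lemma move_root_rooted_class: "move_root f n (rooted_class G u) = rooted_class G ((f G ^^ n) u)"
proof -
  let ?x = "rooted_class G u"
  obtain \<sigma> \<tau> where iso: "graph_iso \<sigma> \<tau> G (net_of ?x)" and r: "root_of ?x = \<sigma> u"
    by (rule rep_iso)
  note * = vertex_shift_funpow[OF f G rep_rooted(1) iso u, of n]
  have "rooted_iso G [(f G ^^ n) u] (net_of ?x) [(f (net_of ?x) ^^ n) (root_of ?x)]"
    using iso * r by (auto simp: rooted_iso_def)
  moreover have "(f (net_of ?x) ^^ n) (root_of ?x) \<in> verts (net_of ?x)"
    using vertex_shift_funpow(1)[OF f rep_rooted(1) rep_rooted(1) graph_iso_id rep_rooted(2)] .
  ultimately show ?thesis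
    using rooted_class_eq_iff[OF G *(1) rep_rooted(1)[of ?x]] unfolding move_root_def by metis
qed

lemma eventually_fixed_rooted_class:
  "eventually_fixed f (rooted_class G u) \<longleftrightarrow> (\<exists>k. \<forall>n \<ge> k. (f G ^^ (n + 1)) u = (f G ^^ n) u)"
proof -
  let ?x = "rooted_class G u"
  obtain \<sigma> \<tau> where iso: "graph_iso \<sigma> \<tau> G (net_of ?x)" and r: "root_of ?x = \<sigma> u"
    by (rule rep_iso)
  note * = vertex_shift_funpow[OF f G rep_rooted(1) iso u]
  have "inj_on \<sigma> (verts G)" using iso by (simp add: graph_iso_def bij_betw_def)
  then have "(f (net_of ?x) ^^ (n + 1)) (root_of ?x) = (f (net_of ?x) ^^ n) (root_of ?x) \<longleftrightarrow>
      (f G ^^ (n + 1)) u = (f G ^^ n) u" for n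
    unfolding r *(2) using *(1)[of "n + 1"] *(1)[of n] by (simp only: inj_on_eq_iff)
  then show ?thesis by (simp only: eventually_fixed_def)
qed

lemma trap_rooted_class: "trap f (rooted_class G u) \<longleftrightarrow> f G u = u"
proof -
  let ?x = "rooted_class G u"
  obtain \<sigma> \<tau> where iso: "graph_iso \<sigma> \<tau> G (net_of ?x)" and r: "root_of ?x = \<sigma> u"
    by (rule rep_iso)
  note * = vertex_shift_funpow[OF f G rep_rooted(1) iso u, of 1]
  have "inj_on \<sigma> (verts G)" using iso by (simp add: graph_iso_def bij_betw_def)
  then show ?thesis using * r u by (auto simp: trap_def inj_on_eq_iff)
qed

lemma d_n_rooted_class:
  "d_n f n (rooted_class G u) = emeasure (count_space (verts G)) {v \<in> verts G. (f G ^^ n) v = u}"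
proof -
  let ?x = "rooted_class G u"
  let ?A = "{v \<in> verts G. (f G ^^ n) v = u}"
  let ?B = "{v \<in> verts (net_of ?x). (f (net_of ?x) ^^ n) v = root_of ?x}"
  obtain \<sigma> \<tau> where iso: "graph_iso \<sigma> \<tau> G (net_of ?x)" and r: "root_of ?x = \<sigma> u"
    by (rule rep_iso)
  note * = vertex_shift_funpow[OF f G rep_rooted(1) iso, of _ n]
  have inj: "inj_on \<sigma> (verts G)" and img: "\<sigma> ` verts G = verts (net_of ?x)"
    using iso by (simp_all add: graph_iso_def bij_betw_def)
  have B: "?B = \<sigma> ` ?A"
    unfolding img[symmetric] r using * inj u by (auto simp: inj_on_eq_iff)
  have injA: "inj_on \<sigma> ?A" using inj by (rule inj_on_subset) auto
  have "emeasure (count_space (verts (net_of ?x))) ?B = emeasure (count_space (verts G)) ?A"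
    unfolding B using injA img
    by (subst (1 2) emeasure_count_space) (auto simp: card_image finite_image_iff)
  then show ?thesis by (simp add: d_n_def)
qed

end

end

theory Submission
  imports Defs
begin

text \<open>
  Cylinders form countably many clopen sets that refine each other, hence they generate the Borel sets
  and a weak limit is determined by its values on them. Along an orbit that reaches a trap the sequence
  \<open>[G, f\<^sup>n(o)]\<close> is eventually constant, and dominated convergence identifies \<open>P\<^sub>0\<^sup>f\<close> with the
  law of its limit.

  For unimodular \<open>P\<^sub>0\<close>, iterating the mass transport principle gives
  \<open>E[\<psi>[G, f\<^sup>n(o)]] = E[\<psi>[G, o] d\<^sub>n(o)]\<close> for every measurable \<open>\<psi> \<ge> 0\<close>. Apply this to the indicator of a set
  of networks rooted at a trap: at a trap \<open>d\<^sub>n\<close> increases with \<open>n\<close>, and \<open>f\<^sup>n(o)\<close> stays put once it is a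
  trap, so both sides converge monotonically, to the \<open>d\<^sub>\<infinity>\<close>-weighted mass and to \<open>P\<^sub>0\<^sup>f\<close>.
\<close>

section \<open>Isomorphisms of balls\<close>

text \<open>The triangle inequality for the graph distance: two walks are concatenated.\<close>

lemma ball_verts_relpow:
  assumes "w \<in> ball_verts G os k" "(w, v) \<in> adj G ^^ j" "v \<in> verts G" "k + j \<le> r"
  shows "v \<in> ball_verts G os r"
proof -
  obtain u i where u: "u \<in> set os" "i \<le> k" "(u, w) \<in> adj G ^^ i"
    using assms(1) by (auto simp: ball_verts_def)
  have "(u, v) \<in> adj G ^^ (i + j)"
    using u(3) assms(2) by (auto simp: relpow_add)
  moreover have "i + j \<le> r" using u(2) assms(4) by simp
  ultimately show ?thesis
    using assms(3) u(1) unfolding ball_verts_def by blast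
qed

lemma ball_verts_mono: "k \<le> r \<Longrightarrow> ball_verts G os k \<subseteq> ball_verts G os r"
  unfolding ball_verts_def by (blast intro: le_trans)

lemma ball_verts_subset: "ball_verts G os r \<subseteq> verts G"
  by (auto simp: ball_verts_def)

lemma roots_in_ball_verts: "set os \<subseteq> verts G \<Longrightarrow> set os \<subseteq> ball_verts G os r"
  unfolding ball_verts_def by (force intro: exI[of _ 0])

lemma adj_verts: "network G \<Longrightarrow> (u, v) \<in> adj G \<Longrightarrow> u \<in> verts G \<and> v \<in> verts G"
  by (auto simp: adj_def network_def)

lemma graph_iso_adj:
  assumes "network G" "network H" "graph_iso \<sigma> \<tau> (net_ball G os R) (net_ball H ps R)"
    and "(a, b) \<in> adj G" "a \<in> ball_verts G os R" "b \<in> ball_verts G os R"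
  shows "(\<sigma> a, \<sigma> b) \<in> adj H"
proof -
  obtain e where e: "e \<in> edges G" "ends G e = {a, b}"
    using assms(4) by (auto simp: adj_def)
  then have "e \<in> edges (net_ball G os R)"
    using assms(5,6) by (simp add: net_ball_def)
  then have "\<tau> e \<in> edges (net_ball H ps R)" "ends H (\<tau> e) = \<sigma> ` ends G e"
    using assms(3) by (auto simp: graph_iso_def bij_betw_def net_ball_def)
  then show ?thesis
    using e by (auto simp: adj_def net_ball_def)
qed

text \<open>A walk of length at most \<open>r\<close> from a root in \<open>os'\<close> stays within
  distance \<open>k + r \<le> R\<close> of \<open>os\<close>. All its edges therefore lie in the
  ball on which \<sigma> is an isomorphism, and the walk is carried over step by step. The induction
  keeps track of where the endpoint lies as well as of the image walk.\<close>

lemma graph_iso_ball_verts_subset: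
  assumes G: "network G" and H: "network H"
    and iso: "graph_iso \<sigma> \<tau> (net_ball G os R) (net_ball H ps R)"
    and os': "set os' \<subseteq> ball_verts G os k" and le: "k + r \<le> R"
  shows "\<sigma> ` ball_verts G os' r \<subseteq> ball_verts H (map \<sigma> os') r"
proof
  fix y assume "y \<in> \<sigma> ` ball_verts G os' r"
  then obtain v where v: "v \<in> ball_verts G os' r" "y = \<sigma> v" by blast
  then obtain u j where u: "u \<in> set os'" "j \<le> r" "(u, v) \<in> adj G ^^ j"
    by (auto simp: ball_verts_def)
  have "(\<sigma> u, \<sigma> v) \<in> adj H ^^ j \<and> v \<in> ball_verts G os (k + j)"
    using u(3,2)
  proof (induction j arbitrary: v)
    case 0
    then show ?case using u(1) os' by auto
  next
    case (Suc j)
    then obtain w where w: "(u, w) \<in> adj G ^^ j" "(w, v) \<in> adj G" by auto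
    with Suc have IH: "(\<sigma> u, \<sigma> w) \<in> adj H ^^ j" "w \<in> ball_verts G os (k + j)" by auto
    have v: "v \<in> ball_verts G os (k + Suc j)"
      using ball_verts_relpow[OF IH(2), of v 1] w(2) adj_verts[OF G w(2)] by auto
    have "(\<sigma> w, \<sigma> v) \<in> adj H"
      using graph_iso_adj[OF G H iso w(2)] IH(2) v ball_verts_mono[of "k + j" R G os]
        ball_verts_mono[of "k + Suc j" R G os] le Suc.prems by auto
    then show ?case using IH(1) v by auto
  qed
  moreover have "\<sigma> v \<in> verts H"
  proof -
    have "v \<in> ball_verts G os R"
      using calculation ball_verts_mono[of "k + j" R G os] le u by auto
    then have "\<sigma> v \<in> ball_verts H ps R"
      using iso by (auto simp: graph_iso_def net_ball_def bij_betw_def)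
    then show ?thesis using ball_verts_subset by blast
  qed
  ultimately show "y \<in> ball_verts H (map \<sigma> os') r"
    unfolding ball_verts_def using u(1,2) v(2) by auto
qed

text \<open>Moving the roots by at most \<open>k\<close> costs \<open>k\<close> of the radius. The
  case \<open>k = 0\<close> shrinks the radius and drops, permutes or repeats roots; larger
  \<open>k\<close> adds a second root away from the first. The inclusion of vertex balls is applied
  to \<sigma> and to its inverse.\<close>

lemma graph_iso_restrict_ball:
  assumes G: "network G" and H: "network H"
    and iso: "graph_iso \<sigma> \<tau> (net_ball G os R) (net_ball H ps R)" and ps: "ps = map \<sigma> os"
    and os: "set os \<subseteq> verts G"
    and os': "set os' \<subseteq> ball_verts G os k" and le: "k + r \<le> R"
  shows "graph_iso \<sigma> \<tau> (net_ball G os' r) (net_ball H (map \<sigma> os') r)"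
proof -
  let ?B = "ball_verts G os R" and ?C = "ball_verts H ps R"
  let ?s = "inv_into ?B \<sigma>" and ?t = "inv_into (edges (net_ball G os R)) \<tau>"
  have bs: "bij_betw \<sigma> ?B ?C"
    and bt: "bij_betw \<tau> (edges (net_ball G os R)) (edges (net_ball H ps R))"
    using iso by (auto simp: graph_iso_def net_ball_def)
  have s: "?s (\<sigma> v) = v" if "v \<in> ?B" for v
    using bs that by (simp add: bij_betw_inv_into_left)
  have os'B: "set os' \<subseteq> ?B" using os' ball_verts_mono[of k R G os] le by auto
  have inv: "graph_iso ?s ?t (net_ball H ps R) (net_ball G os R)"
    using graph_iso_sym[OF _ iso] by (auto simp: net_ball_def)
  \<comment> \<open>To apply the inclusion to the inverse, the moved roots must also be close to
    \<open>ps\<close> in \<open>H\<close>.\<close>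
  have "set (map \<sigma> os') \<subseteq> \<sigma> ` ball_verts G os k" using os' by auto
  also have "\<dots> \<subseteq> ball_verts H ps k"
    unfolding ps using graph_iso_ball_verts_subset[OF G H iso, of os 0 k]
      roots_in_ball_verts[OF os] le by auto
  finally have ps': "set (map \<sigma> os') \<subseteq> ball_verts H ps k" .
  have "map ?s (map \<sigma> os') = os'"
    unfolding map_map using s os'B by (intro map_idI) auto
  then have inv_sub: "?s ` ball_verts H (map \<sigma> os') r \<subseteq> ball_verts G os' r"
    using graph_iso_ball_verts_subset[OF H G inv ps' le] by simp
  have sub: "ball_verts G os' r \<subseteq> ?B"
    using ball_verts_relpow[of _ G os k _ _ R] os' le
    by (fastforce simp: ball_verts_def[of G os'])
  have subH: "ball_verts H (map \<sigma> os') r \<subseteq> ?C"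
    using ball_verts_relpow[of _ H ps k _ _ R] ps' le
    by (fastforce simp: ball_verts_def[of H "map \<sigma> os'"])
  have V: "\<sigma> ` ball_verts G os' r = ball_verts H (map \<sigma> os') r"
  proof
    show "\<sigma> ` ball_verts G os' r \<subseteq> ball_verts H (map \<sigma> os') r"
      by (rule graph_iso_ball_verts_subset[OF G H iso os' le])
    show "ball_verts H (map \<sigma> os') r \<subseteq> \<sigma> ` ball_verts G os' r"
    proof
      fix w assume w: "w \<in> ball_verts H (map \<sigma> os') r"
      then have "\<sigma> (?s w) = w" using bs subH by (auto simp: bij_betw_inv_into_right)
      then show "w \<in> \<sigma> ` ball_verts G os' r" using inv_sub w by (metis image_eqI image_subset_iff)
    qed
  qed
  have bij: "bij_betw \<sigma> (ball_verts G os' r) (ball_verts H (map \<sigma> os') r)"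
    using bij_betw_subset[OF bs sub V] .
  have endsH: "ends H (\<tau> e) = \<sigma> ` ends G e" if "e \<in> edges (net_ball G os R)" for e
    using iso that by (auto simp: graph_iso_def net_ball_def)
  have iff: "ends H (\<tau> e) \<subseteq> ball_verts H (map \<sigma> os') r \<longleftrightarrow> ends G e \<subseteq> ball_verts G os' r"
    if e: "e \<in> edges (net_ball G os R)" for e
  proof -
    have "ends G e \<subseteq> ?B" using e by (simp add: net_ball_def)
    moreover have "inj_on \<sigma> ?B" using bs by (simp add: bij_betw_def)
    ultimately show ?thesis
      unfolding endsH[OF e] V[symmetric] using sub inj_on_image_subset_iff by metis
  qed
  \<comment> \<open>Both small edge sets are cut out of the large ones, where \<tau> is already a
    bijection.\<close>
  have EG: "edges (net_ball G os' r) = {e \<in> edges (net_ball G os R). ends G e \<subseteq> ball_verts G os' r}"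
    using sub by (auto simp: net_ball_def)
  have EH: "edges (net_ball H (map \<sigma> os') r) =
      {e \<in> edges (net_ball H ps R). ends H e \<subseteq> ball_verts H (map \<sigma> os') r}"
    using subH by (auto simp: net_ball_def)
  have img: "\<tau> ` edges (net_ball G os' r) = edges (net_ball H (map \<sigma> os') r)"
    unfolding EG EH using bt iff by (fastforce simp: bij_betw_def)
  have "bij_betw \<tau> (edges (net_ball G os' r)) (edges (net_ball H (map \<sigma> os') r))"
    using bij_betw_subset[OF bt _ img] EG by auto
  then show ?thesis
    using bij iso sub EG unfolding graph_iso_def by (auto simp: net_ball_def)
qed

text \<open>This makes cylinders shrink as the radius grows.\<close>

lemma balls_iso_mono:
  assumes "network G" "network H" "set os \<subseteq> verts G" "balls_iso s G os H ps" "r \<le> s"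
  shows "balls_iso r G os H ps"
proof -
  obtain \<sigma> \<tau> where "graph_iso \<sigma> \<tau> (net_ball G os s) (net_ball H ps s)" "ps = map \<sigma> os"
    using assms(4) by (auto simp: balls_iso_def rooted_iso_def)
  then show ?thesis
    using graph_iso_restrict_ball[of G H \<sigma> \<tau> os s ps os 0 r] roots_in_ball_verts[OF assms(3)] assms
    by (auto simp: balls_iso_def rooted_iso_def)
qed

section \<open>Finiteness of balls\<close>

lemma finite_ends: "network G \<Longrightarrow> e \<in> edges G \<Longrightarrow> finite (ends G e)"
  \<comment> \<open>An infinite set has \<open>card\<close> 0, which \<open>network\<close>
    excludes.\<close>
  unfolding network_def by (metis card.infinite insertE singletonD zero_neq_numeral zero_neq_one)

text \<open>Local finiteness and finite edges give finitely many neighbours, so by induction on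
  \<open>k\<close> walks of length \<open>k\<close> reach finitely many vertices; the ball is
  contained in a finite union of such sets.\<close>

lemma finite_ball_verts:
  assumes G: "network G" and os: "set os \<subseteq> verts G"
  shows "finite (ball_verts G os r)"
proof -
  have nb: "finite (adj G `` {w})" if "w \<in> verts G" for w
  proof (rule finite_subset)
    show "adj G `` {w} \<subseteq> (\<Union>e \<in> {e \<in> edges G. w \<in> ends G e}. ends G e)"
      by (auto simp: adj_def)
    show "finite \<dots>" using G that finite_ends[OF G] by (auto simp: network_def)
  qed
  have sph: "finite ((adj G ^^ k) `` {u}) \<and> (adj G ^^ k) `` {u} \<subseteq> verts G" if "u \<in> verts G" for u k
  proof (induction k)
    case (Suc k)
    have "(adj G ^^ Suc k) `` {u} = (\<Union>w \<in> (adj G ^^ k) `` {u}. adj G `` {w})" by auto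
    then show ?case using Suc nb adj_verts[OF G] by auto
  qed (use that in auto)
  have "ball_verts G os r \<subseteq> (\<Union>u \<in> set os. \<Union>k \<in> {..r}. (adj G ^^ k) `` {u})"
    by (auto simp: ball_verts_def)
  then show ?thesis
    by (rule finite_subset) (use sph os in auto)
qed

lemma finite_edges_net_ball:
  assumes G: "network G" and os: "set os \<subseteq> verts G"
  shows "finite (edges (net_ball G os r))"
proof (rule finite_subset)
  show "edges (net_ball G os r) \<subseteq> (\<Union>v \<in> ball_verts G os r. {e \<in> edges G. v \<in> ends G e})"
  proof
    fix e assume "e \<in> edges (net_ball G os r)"
    then have e: "e \<in> edges G" "ends G e \<subseteq> ball_verts G os r" by (auto simp: net_ball_def)
    \<comment> \<open>An edge without endpoints would lie in every ball and escape the union over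
      incident vertices.\<close>
    then have "ends G e \<noteq> {}" using G by (auto simp: network_def)
    then show "e \<in> (\<Union>v \<in> ball_verts G os r. {e \<in> edges G. v \<in> ends G e})" using e by auto
  qed
  show "finite \<dots>"
    using finite_ball_verts[OF G os] G by (auto simp: network_def ball_verts_def)
qed

section \<open>The Borel structure of the network spaces\<close>

type_synonym graph_code = "nat list \<times> nat list \<times> nat list list \<times> int list \<times> int list list"

text \<open>Codes form a countable type. The last three lists are tables looked up at the vertex or
  edge number itself; entries at numbers outside the graph are ignored by isomorphisms.\<close>

definition decode_graph :: "graph_code \<Rightarrow> multigraph" where
  "decode_graph = (\<lambda>(V, E, en, vm, em).
     \<lparr>verts = set V, edges = set E, ends = \<lambda>e. set (en ! e), vmark = \<lambda>v. vm ! v,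
      emark = \<lambda>e v. em ! e ! v\<rparr>)"

text \<open>Vertices and edges keep their numbers, so the identity is the isomorphism. The bound
  \<open>N\<close> makes every table long enough.\<close>

lemma decode_graph_surj:
  assumes "finite (verts G)" "finite (edges G)" "\<forall>e \<in> edges G. ends G e \<subseteq> verts G"
  obtains c where "graph_iso id id G (decode_graph c)" "graph_iso id id (decode_graph c) G"
proof -
  obtain N where N: "\<And>v. v \<in> verts G \<Longrightarrow> v < N" "\<And>e. e \<in> edges G \<Longrightarrow> e < N"
    using finite_nat_set_iff_bounded[of "verts G \<union> edges G"] assms(1,2) by auto
  let ?c = "(sorted_list_of_set (verts G), sorted_list_of_set (edges G),
    map (\<lambda>e. sorted_list_of_set (ends G e)) [0..<N], map (vmark G) [0..<N],
    map (\<lambda>e. map (emark G e) [0..<N]) [0..<N])"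
  have "finite (ends G e)" if "e \<in> edges G" for e
    using assms that finite_subset by metis
  then have "graph_iso id id G (decode_graph ?c)" "graph_iso id id (decode_graph ?c) G"
    using assms N by (auto simp: graph_iso_def decode_graph_def subset_iff)
  then show ?thesis using that by blast
qed

text \<open>The ball is a finite graph, so \<open>balls_iso\<close> depends on \<open>G\<close> only
  through a code, the roots keeping their numbers.\<close>

lemma net_ball_decode:
  assumes G: "network G" and os: "set os \<subseteq> verts G"
  obtains c where "\<And>H ps. balls_iso r G os H ps \<longleftrightarrow> rooted_iso (decode_graph c) os (net_ball H ps r) ps"
proof -
  obtain c where c: "graph_iso id id (net_ball G os r) (decode_graph c)"
      "graph_iso id id (decode_graph c) (net_ball G os r)"
    by (rule decode_graph_surj[of "net_ball G os r"])
      (use finite_ball_verts[OF G os] finite_edges_net_ball[OF G os] in \<open>auto simp: net_ball_def\<close>)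
  then have "rooted_iso (net_ball G os r) os (decode_graph c) os"
      "rooted_iso (decode_graph c) os (net_ball G os r) os"
    unfolding rooted_iso_def by (metis list.map_id)+
  then show ?thesis
    using that unfolding balls_iso_def by (blast intro: rooted_iso_trans)
qed

text \<open>A cylinder is determined by a code, a root and a radius, for which there are countably
  many choices.\<close>

lemma countable_cylinders: "countable {cylinder G u r | G u r. network G \<and> u \<in> verts G}"
proof (rule countable_subset)
  let ?f = "\<lambda>(c, u, r). {rooted_class H p | H p. network H \<and> p \<in> verts H \<and>
    rooted_iso (decode_graph c) [u] (net_ball H [p] r) [p]}"
  show "{cylinder G u r | G u r. network G \<and> u \<in> verts G} \<subseteq> range ?f"
  proof clarify
    fix G u r assume "network G" "u \<in> verts G"
    then have "network G" "set [u] \<subseteq> verts G" by auto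
    then obtain c where
      "\<And>H ps. balls_iso r G [u] H ps \<longleftrightarrow> rooted_iso (decode_graph c) [u] (net_ball H ps r) ps"
      by (rule net_ball_decode) blast
    then have "cylinder G u r = ?f (c, u, r)" by (simp add: cylinder_def)
    then show "cylinder G u r \<in> range ?f" by blast
  qed
qed simp

lemma countable_bicylinders:
  "countable {bicylinder G u v r | G u v r. network G \<and> u \<in> verts G \<and> v \<in> verts G}"
proof (rule countable_subset)
  let ?f = "\<lambda>(c, u, v, r). {birooted_class H p q | H p q. network H \<and> p \<in> verts H \<and> q \<in> verts H \<and>
    rooted_iso (decode_graph c) [u, v] (net_ball H [p, q] r) [p, q]}"
  show "{bicylinder G u v r | G u v r. network G \<and> u \<in> verts G \<and> v \<in> verts G} \<subseteq> range ?f"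
  proof clarify
    fix G u v r assume "network G" "u \<in> verts G" "v \<in> verts G"
    then have "network G" "set [u, v] \<subseteq> verts G" by auto
    then obtain c where
      "\<And>H ps. balls_iso r G [u, v] H ps \<longleftrightarrow> rooted_iso (decode_graph c) [u, v] (net_ball H ps r) ps"
      by (rule net_ball_decode) blast
    then have "bicylinder G u v r = ?f (c, u, v, r)" by (simp add: bicylinder_def)
    then show "bicylinder G u v r \<in> range ?f" by blast
  qed
qed simp

section \<open>Topology and Borel sets generated by refining countable partitions\<close>

text \<open>\<open>C r x\<close> is the class of \<open>x\<close> in the \<open>r\<close>-th partition of a refining sequence.\<close>

locale refining_partitions =
  fixes C :: "nat \<Rightarrow> 'a::topological_space \<Rightarrow> 'a set"
  assumes self: "x \<in> C r x"
    and eq: "y \<in> C r x \<Longrightarrow> C r y = C r x"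
    and antimono: "r \<le> s \<Longrightarrow> C s x \<subseteq> C r x"
    and generates: "open = generate_topology {C r x | r x. True}"
    and countable_classes: "countable {C r x | r x. True}"
begin

lemma open_class: "open (C r x)"
  unfolding generates by (rule generate_topology.Basis) blast

text \<open>The partitions refine each other, so of two classes through a point one contains the
  other, and by \<open>eq\<close> a generator containing \<open>x\<close> is itself a class of
  \<open>x\<close>. The classes of \<open>x\<close> are thus a neighbourhood base.\<close>

lemma open_iff: "open A \<longleftrightarrow> (\<forall>x \<in> A. \<exists>r. C r x \<subseteq> A)"
proof
  assume "open A"
  then have "generate_topology {C r x | r x. True} A" by (simp only: generates)
  then show "\<forall>x \<in> A. \<exists>r. C r x \<subseteq> A"
  proof induction
    case (Int a b)
    show ?case
    proof
      fix x assume "x \<in> a \<inter> b"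
      then obtain r s where "C r x \<subseteq> a" "C s x \<subseteq> b" using Int by blast
      then have "C (max r s) x \<subseteq> a \<inter> b"
        using antimono[of r "max r s" x] antimono[of s "max r s" x] by auto
      then show "\<exists>r. C r x \<subseteq> a \<inter> b" by blast
    qed
  next
    case (UN K)
    then show ?case by (meson Union_iff Union_upper subset_trans)
  next
    case (Basis s)
    then show ?case using eq by blast
  qed auto
next
  assume "\<forall>x \<in> A. \<exists>r. C r x \<subseteq> A"
  then obtain r where "\<And>x. x \<in> A \<Longrightarrow> C (r x) x \<subseteq> A" by metis
  then have "A = (\<Union>x \<in> A. C (r x) x)" using self by blast
  moreover have "open (\<Union>x \<in> A. C (r x) x)" by (intro open_UN ballI open_class)
  ultimately show "open A" by simp
qed

text \<open>The complement is a union of classes of the same level.\<close>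

lemma closed_class: "closed (C r x)"
  unfolding closed_def open_iff
proof
  fix y assume y: "y \<in> - C r x"
  have "C r y \<subseteq> - C r x"
  proof
    fix z assume "z \<in> C r y"
    then have "C r z = C r y" by (rule eq)
    then show "z \<in> - C r x" using y eq[of z r x] self[of y r] by auto
  qed
  then show "\<exists>s. C s y \<subseteq> - C r x" by blast
qed

text \<open>The classes form a countable basis. The empty set is added so that the generator also
  contains the intersection of disjoint classes.\<close>

lemma borel_eq: "borel = sigma UNIV (insert {} {C r x | r x. True})"
proof (rule borel_eq_countable_basis)
  show "countable (insert {} {C r x | r x. True})" using countable_classes by simp
  show "topological_basis (insert {} {C r x | r x. True})"
  proof (rule topological_basisI)
    fix B assume "B \<in> insert {} {C r x | r x. True}"
    then show "open B" using open_class by auto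
  next
    fix A and x :: 'a assume "open A" "x \<in> A"
    then obtain r where "C r x \<subseteq> A" unfolding open_iff by blast
    then show "\<exists>B \<in> insert {} {C r x | r x. True}. x \<in> B \<and> B \<subseteq> A" using self by blast
  qed
qed

text \<open>Two classes that meet are nested, so their intersection is the finer one.\<close>

lemma Int_stable_classes: "Int_stable (insert {} {C r x | r x. True})"
proof (rule Int_stableI)
  have *: "C r x \<inter> C s y \<in> insert {} {C r x | r x. True}" if "r \<le> s" for r s x y
  proof (cases "C r x \<inter> C s y = {}")
    case False
    then obtain z where "z \<in> C r x" "z \<in> C s y" by blast
    then have "C r x = C r z" "C s y = C s z" using eq by blast+
    then have "C r x \<inter> C s y = C s z" using antimono[OF that] by blast
    then show ?thesis by blast
  qed auto
  fix a b assume "a \<in> insert {} {C r x | r x. True}" "b \<in> insert {} {C r x | r x. True}"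
  then show "a \<inter> b \<in> insert {} {C r x | r x. True}"
  proof (cases "a = {} \<or> b = {}")
    case False
    then obtain r s x y where "a = C r x" "b = C s y"
      using \<open>a \<in> _\<close> \<open>b \<in> _\<close> by blast
    then show ?thesis using *[of r s x y] *[of s r y x] by (metis Int_commute nat_le_linear)
  qed auto
qed

end

text \<open>A single \<sigma> serves all root lists and radii at once: counting vertices in a ball
  needs the bijection of balls and the isomorphisms around moved roots to come from the same
  map.\<close>

lemma balls_iso_restrict:
  assumes "network G" "network H" "set os \<subseteq> verts G" "balls_iso R G os H ps"
  obtains \<sigma> where "ps = map \<sigma> os"
    "\<And>os' k r. set os' \<subseteq> ball_verts G os k \<Longrightarrow> k + r \<le> R \<Longrightarrow> balls_iso r G os' H (map \<sigma> os')"
    "\<And>r. r \<le> R \<Longrightarrow> bij_betw \<sigma> (ball_verts G os r) (ball_verts H ps r)"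
proof -
  obtain \<sigma> \<tau> where iso: "graph_iso \<sigma> \<tau> (net_ball G os R) (net_ball H ps R)" and ps: "ps = map \<sigma> os"
    using assms(4) by (auto simp: balls_iso_def rooted_iso_def)
  note restrict = graph_iso_restrict_ball[OF assms(1,2) iso ps assms(3)]
  show ?thesis
  proof (rule that[OF ps])
    show "balls_iso r G os' H (map \<sigma> os')" if "set os' \<subseteq> ball_verts G os k" "k + r \<le> R" for os' k r
      using restrict[OF that] by (auto simp: balls_iso_def rooted_iso_def)
    show "bij_betw \<sigma> (ball_verts G os r) (ball_verts H ps r)" if "r \<le> R" for r
      using restrict[of os 0 r] roots_in_ball_verts[OF assms(3)] that ps
      by (auto simp: graph_iso_def net_ball_def)
  qed
qed

context refining_partitions
begin

text \<open>The preimage of any set is a union of classes, hence open, whatever the \<sigma>-algebra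
  of \<open>N\<close>.\<close>

lemma measurable_of_constant_on_classes:
  assumes "\<And>x y. y \<in> C k x \<Longrightarrow> h y = h x" "space N = UNIV"
  shows "h \<in> measurable borel N"
proof (rule measurableI)
  fix A assume "A \<in> sets N"
  have "open (h -` A)" unfolding open_iff using assms(1) by blast
  then show "h -` A \<inter> space borel \<in> sets borel" by simp
qed (use assms(2) in auto)

text \<open>The hypothesis is continuity, expressed through the neighbourhood bases of
  classes.\<close>

lemma borel_measurable_of_map_classes:
  fixes D :: "nat \<Rightarrow> 'b::topological_space \<Rightarrow> 'b set" and \<phi> :: "'a \<Rightarrow> 'b"
  assumes D: "refining_partitions D" and \<phi>: "\<And>r x. \<exists>s. \<phi> ` C s x \<subseteq> D r (\<phi> x)"
  shows "\<phi> \<in> borel_measurable borel"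
proof (rule borel_measurableI)
  fix S :: "'b set" assume S: "open S"
  have "open (\<phi> -` S)"
    unfolding open_iff
  proof
    fix x assume "x \<in> \<phi> -` S"
    then obtain r where "D r (\<phi> x) \<subseteq> S"
      using S refining_partitions.open_iff[OF D] by auto
    then show "\<exists>s. C s x \<subseteq> \<phi> -` S" using \<phi>[of x r] by blast
  qed
  then show "\<phi> -` S \<inter> space borel \<in> sets borel" by simp
qed

end

section \<open>Cylinders as partitions of the space of rooted networks\<close>

abbreviation rooted_part :: "nat \<Rightarrow> rooted_network \<Rightarrow> rooted_network set" where
  "rooted_part r x \<equiv> cylinder (net_of x) (root_of x) r"

lemma in_cylinder_iff: "y \<in> cylinder G u r \<longleftrightarrow> balls_iso r G [u] (net_of y) [root_of y]"
  using rooted_class_in_cylinder_iff[OF rep_rooted(1,2)[of y]] by (simp add: rep_rooted(3))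

lemma cylinder_eq:
  assumes "u \<in> verts G" "y \<in> cylinder G u r"
  shows "rooted_part r y = cylinder G u r"
proof -
  have 1: "balls_iso r G [u] (net_of y) [root_of y]"
    using assms(2) by (simp add: in_cylinder_iff)
  have 2: "balls_iso r (net_of y) [root_of y] G [u]"
    using assms(1) by (intro balls_iso_sym[OF _ 1]) auto
  then show ?thesis
    using balls_iso_trans[OF 1] balls_iso_trans[OF 2] by (auto simp: in_cylinder_iff)
qed

text \<open>The partition does not depend on the representatives chosen by \<open>net_of\<close> and
  \<open>root_of\<close>.\<close>

lemma rooted_class_part:
  assumes "network G" "u \<in> verts G"
  shows "rooted_part r (rooted_class G u) = cylinder G u r"
  by (rule cylinder_eq) (use assms in \<open>simp_all add: rooted_class_in_cylinder_iff balls_iso_refl\<close>)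

global_interpretation rooted: refining_partitions rooted_part
proof
  have eq: "{rooted_part r x | r x. True} = {cylinder G u r | G u r. network G \<and> u \<in> verts G}"
    using rep_rooted(1,2) rooted_class_part by blast
  show "open = generate_topology {rooted_part r x | r x. True}"
    unfolding eq by (rule open_rooted_network_def)
  show "countable {rooted_part r x | r x. True}"
    unfolding eq by (rule countable_cylinders)
  show "rooted_part s x \<subseteq> rooted_part r x" if "r \<le> s" for r s x
    using balls_iso_mono[OF rep_rooted(1) rep_rooted(1) _ _ that] rep_rooted(2)
    by (auto simp: in_cylinder_iff)
qed (simp_all add: in_cylinder_iff balls_iso_refl cylinder_eq rep_rooted(2))

section \<open>Representatives and bicylinders of doubly rooted networks\<close>

definition binet_of :: "birooted_network \<Rightarrow> multigraph" where
  "binet_of z = fst (rep_birooted_network z)"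

definition root1 :: "birooted_network \<Rightarrow> nat" where
  "root1 z = fst (snd (rep_birooted_network z))"

definition root2 :: "birooted_network \<Rightarrow> nat" where
  "root2 z = snd (snd (rep_birooted_network z))"

lemma rep_birooted:
  "network (binet_of z)" "root1 z \<in> verts (binet_of z)" "root2 z \<in> verts (binet_of z)"
  "birooted_class (binet_of z) (root1 z) (root2 z) = z"
proof -
  have "birooted_rel (rep_birooted_network z) (rep_birooted_network z)"
    by (rule Quotient3_rep_reflp[OF Quotient3_birooted_network])
  then show "network (binet_of z)" "root1 z \<in> verts (binet_of z)" "root2 z \<in> verts (binet_of z)"
    by (auto simp: binet_of_def root1_def root2_def birooted_rel_def split: prod.splits)
  show "birooted_class (binet_of z) (root1 z) (root2 z) = z"
    by (simp add: birooted_class_def binet_of_def root1_def root2_def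
        Quotient3_abs_rep[OF Quotient3_birooted_network])
qed

abbreviation birooted_part :: "nat \<Rightarrow> birooted_network \<Rightarrow> birooted_network set" where
  "birooted_part r z \<equiv> bicylinder (binet_of z) (root1 z) (root2 z) r"

lemma in_bicylinder_iff:
  "w \<in> bicylinder G u v r \<longleftrightarrow> balls_iso r G [u, v] (binet_of w) [root1 w, root2 w]"
  using birooted_class_in_bicylinder_iff[OF rep_birooted(1-3)[of w]] by (simp add: rep_birooted(4))

lemma bicylinder_eq:
  assumes "u \<in> verts G" "v \<in> verts G" "w \<in> bicylinder G u v r"
  shows "birooted_part r w = bicylinder G u v r"
proof -
  have 1: "balls_iso r G [u, v] (binet_of w) [root1 w, root2 w]"
    using assms(3) by (simp add: in_bicylinder_iff)
  have 2: "balls_iso r (binet_of w) [root1 w, root2 w] G [u, v]"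
    using assms(1,2) by (intro balls_iso_sym[OF _ 1]) auto
  then show ?thesis
    using balls_iso_trans[OF 1] balls_iso_trans[OF 2] by (auto simp: in_bicylinder_iff)
qed

lemma birooted_class_part:
  assumes "network G" "u \<in> verts G" "v \<in> verts G"
  shows "birooted_part r (birooted_class G u v) = bicylinder G u v r"
  by (rule bicylinder_eq) (use assms in \<open>simp_all add: birooted_class_in_bicylinder_iff balls_iso_refl\<close>)

global_interpretation birooted: refining_partitions birooted_part
proof
  have eq: "{birooted_part r x | r x. True} =
      {bicylinder G u v r | G u v r. network G \<and> u \<in> verts G \<and> v \<in> verts G}"
    using rep_birooted(1-3) birooted_class_part by blast
  show "open = generate_topology {birooted_part r x | r x. True}"
    unfolding eq by (rule open_birooted_network_def)
  show "countable {birooted_part r x | r x. True}"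
    unfolding eq by (rule countable_bicylinders)
  show "birooted_part s x \<subseteq> birooted_part r x" if "r \<le> s" for r s x
    using balls_iso_mono[OF rep_birooted(1) rep_birooted(1) _ _ that] rep_birooted(2,3)
    by (auto simp: in_bicylinder_iff)
qed (simp_all add: in_bicylinder_iff balls_iso_refl bicylinder_eq rep_birooted(2,3))

section \<open>Forgetting, exchanging and doubling roots\<close>

definition forget1 :: "birooted_network \<Rightarrow> rooted_network" where
  "forget1 z = rooted_class (binet_of z) (root2 z)"

definition forget2 :: "birooted_network \<Rightarrow> rooted_network" where
  "forget2 z = rooted_class (binet_of z) (root1 z)"

text \<open>Reduces sums in which the summation variable is the first root to those in which it is
  the second.\<close>

definition swap_roots :: "birooted_network \<Rightarrow> birooted_network" where
  "swap_roots z = birooted_class (binet_of z) (root2 z) (root1 z)"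

text \<open>Traps are the preimage of \<open>shift_graph\<close> under this map, which gives the
  measurability of \<open>trap\<close>.\<close>

definition double_root :: "rooted_network \<Rightarrow> birooted_network" where
  "double_root x = birooted_class (net_of x) (root_of x) (root_of x)"

lemma rep_birooted_class:
  assumes "network G" "u \<in> verts G" "v \<in> verts G"
  obtains \<sigma> \<tau> where "graph_iso \<sigma> \<tau> G (binet_of (birooted_class G u v))"
    "root1 (birooted_class G u v) = \<sigma> u" "root2 (birooted_class G u v) = \<sigma> v"
proof -
  let ?z = "birooted_class G u v"
  have "rooted_iso G [u, v] (binet_of ?z) [root1 ?z, root2 ?z]"
    using birooted_class_eq_iff[OF assms rep_birooted(1-3)[of ?z]] rep_birooted(4)[of ?z] by simp
  then show ?thesis using that by (auto simp: rooted_iso_def)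
qed

lemma
  assumes G: "network G" "u \<in> verts G" "v \<in> verts G"
  shows forget1_class: "forget1 (birooted_class G u v) = rooted_class G v"
    and forget2_class: "forget2 (birooted_class G u v) = rooted_class G u"
    and swap_roots_class: "swap_roots (birooted_class G u v) = birooted_class G v u"
proof -
  let ?z = "birooted_class G u v"
  obtain \<sigma> \<tau> where iso: "graph_iso \<sigma> \<tau> G (binet_of ?z)" and r: "root1 ?z = \<sigma> u" "root2 ?z = \<sigma> v"
    by (rule rep_birooted_class[OF G])
  note rep = rep_birooted(1-3)[of ?z]
  have "rooted_iso G [v] (binet_of ?z) [root2 ?z]" "rooted_iso G [u] (binet_of ?z) [root1 ?z]"
    "rooted_iso G [v, u] (binet_of ?z) [root2 ?z, root1 ?z]"
    using iso r by (auto simp: rooted_iso_def)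
  then show "forget1 ?z = rooted_class G v" "forget2 ?z = rooted_class G u"
    "swap_roots ?z = birooted_class G v u"
    using rooted_class_eq_iff[OF G(1,3) rep(1,3)] rooted_class_eq_iff[OF G(1,2) rep(1,2)]
      birooted_class_eq_iff[OF G(1,3,2) rep(1,3,2)]
    by (simp_all add: forget1_def forget2_def swap_roots_def)
qed

text \<open>The selected roots are at distance 0 from the given ones, so no radius is lost.\<close>

lemma birooted_part_restrict:
  assumes "w \<in> birooted_part r z"
  shows "balls_iso r (binet_of z) [root1 z] (binet_of w) [root1 w]"
    and "balls_iso r (binet_of z) [root2 z] (binet_of w) [root2 w]"
    and "balls_iso r (binet_of z) [root2 z, root1 z] (binet_of w) [root2 w, root1 w]"
proof -
  have sub: "set [root1 z, root2 z] \<subseteq> verts (binet_of z)" using rep_birooted by auto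
  obtain \<sigma> where \<sigma>: "[root1 w, root2 w] = map \<sigma> [root1 z, root2 z]"
    "\<And>os k s. set os \<subseteq> ball_verts (binet_of z) [root1 z, root2 z] k \<Longrightarrow> k + s \<le> r \<Longrightarrow>
       balls_iso s (binet_of z) os (binet_of w) (map \<sigma> os)"
    using balls_iso_restrict[OF rep_birooted(1)[of z] rep_birooted(1)[of w] sub
        assms[unfolded in_bicylinder_iff]] by metis
  have "set [root1 z, root2 z] \<subseteq> ball_verts (binet_of z) [root1 z, root2 z] 0"
    by (rule roots_in_ball_verts[OF sub])
  then show "balls_iso r (binet_of z) [root1 z] (binet_of w) [root1 w]"
    "balls_iso r (binet_of z) [root2 z] (binet_of w) [root2 w]"
    "balls_iso r (binet_of z) [root2 z, root1 z] (binet_of w) [root2 w, root1 w]"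
    using \<sigma>(1) \<sigma>(2)[of "[root1 z]" 0 r] \<sigma>(2)[of "[root2 z]" 0 r] \<sigma>(2)[of "[root2 z, root1 z]" 0 r]
    by simp_all
qed

lemma measurable_forget1 [measurable]: "forget1 \<in> borel_measurable borel"
proof (rule birooted.borel_measurable_of_map_classes[OF rooted.refining_partitions_axioms])
  show "\<exists>s. forget1 ` birooted_part s z \<subseteq> rooted_part r (forget1 z)" for r z
    using rep_birooted birooted_part_restrict(2)
    by (intro exI[of _ r]) (auto simp: forget1_def rooted_class_part rooted_class_in_cylinder_iff)
qed

lemma measurable_forget2 [measurable]: "forget2 \<in> borel_measurable borel"
proof (rule birooted.borel_measurable_of_map_classes[OF rooted.refining_partitions_axioms])
  show "\<exists>s. forget2 ` birooted_part s z \<subseteq> rooted_part r (forget2 z)" for r z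
    using rep_birooted birooted_part_restrict(1)
    by (intro exI[of _ r]) (auto simp: forget2_def rooted_class_part rooted_class_in_cylinder_iff)
qed

lemma measurable_swap_roots [measurable]: "swap_roots \<in> borel_measurable borel"
proof (rule birooted.borel_measurable_of_map_classes[OF birooted.refining_partitions_axioms])
  show "\<exists>s. swap_roots ` birooted_part s z \<subseteq> birooted_part r (swap_roots z)" for r z
    using rep_birooted birooted_part_restrict(3)
    by (intro exI[of _ r])
      (auto simp: swap_roots_def birooted_class_part birooted_class_in_bicylinder_iff)
qed

lemma measurable_double_root [measurable]: "double_root \<in> borel_measurable borel"
proof (rule rooted.borel_measurable_of_map_classes[OF birooted.refining_partitions_axioms])
  show "\<exists>s. double_root ` rooted_part s x \<subseteq> birooted_part r (double_root x)" for r x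
  proof (intro exI image_subsetI)
    fix y assume "y \<in> rooted_part r x"
    then have "balls_iso r (net_of x) [root_of x] (net_of y) [root_of y]"
      by (simp add: in_cylinder_iff)
    moreover have sub: "set [root_of x] \<subseteq> verts (net_of x)" using rep_rooted by auto
    ultimately obtain \<sigma> where "[root_of y] = map \<sigma> [root_of x]"
      "\<And>os k s. set os \<subseteq> ball_verts (net_of x) [root_of x] k \<Longrightarrow> k + s \<le> r \<Longrightarrow>
         balls_iso s (net_of x) os (net_of y) (map \<sigma> os)"
      using balls_iso_restrict[OF rep_rooted(1)[of x] rep_rooted(1)[of y]] by metis
    \<comment> \<open>Repeating the root costs no radius.\<close>
    from this(1) this(2)[of "[root_of x, root_of x]" 0 r]
    have "balls_iso r (net_of x) [root_of x, root_of x] (net_of y) [root_of y, root_of y]"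
      using roots_in_ball_verts[OF sub, of 0] by simp
    then show "double_root y \<in> birooted_part r (double_root x)"
      using rep_rooted by (simp add: double_root_def birooted_class_part birooted_class_in_bicylinder_iff)
  qed
qed

section \<open>Measurability of sums over vertices\<close>

text \<open>Restricting the second root to a ball makes the counts finite, as the complement step of the
  \<open>\<pi>\<close>-\<open>\<lambda>\<close> argument requires; on a bicylinder the count is a locally constant function of the
  rooted network.\<close>

definition root_kernel :: "nat \<Rightarrow> rooted_network \<Rightarrow> birooted_network measure" where
  "root_kernel r x = distr (count_space (ball_verts (net_of x) [root_of x] r)) borel
     (\<lambda>u. birooted_class (net_of x) (root_of x) u)"

lemma emeasure_root_kernel:
  assumes "B \<in> sets borel"
  shows "emeasure (root_kernel r x) B =
    of_nat (card {u \<in> ball_verts (net_of x) [root_of x] r. birooted_class (net_of x) (root_of x) u \<in> B})"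
proof -
  have "finite (ball_verts (net_of x) [root_of x] r)"
    using rep_rooted by (intro finite_ball_verts) auto
  moreover have "birooted_class (net_of x) (root_of x) -` B \<inter> ball_verts (net_of x) [root_of x] r =
      {u \<in> ball_verts (net_of x) [root_of x] r. birooted_class (net_of x) (root_of x) u \<in> B}" by auto
  ultimately show ?thesis
    using assms unfolding root_kernel_def by (simp add: emeasure_distr)
qed

text \<open>A vertex within \<open>r\<close> of the root still has radius \<open>s\<close> left
  inside the ball of radius \<open>r + s\<close>. The map \<sigma> therefore preserves membership in
  \<open>B\<close> and matches the vertices counted on both sides.\<close>

lemma root_kernel_constant:
  assumes B: "B \<in> sets borel" "\<And>z w. w \<in> birooted_part s z \<Longrightarrow> w \<in> B \<longleftrightarrow> z \<in> B"
    and y: "y \<in> rooted_part (r + s) x"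
  shows "emeasure (root_kernel r y) B = emeasure (root_kernel r x) B"
proof -
  let ?G = "net_of x" and ?H = "net_of y" and ?u = "root_of x" and ?p = "root_of y"
  have sub: "set [?u] \<subseteq> verts ?G" using rep_rooted by auto
  obtain \<sigma> where \<sigma>: "[?p] = map \<sigma> [?u]"
    "\<And>os k t. set os \<subseteq> ball_verts ?G [?u] k \<Longrightarrow> k + t \<le> r + s \<Longrightarrow> balls_iso t ?G os ?H (map \<sigma> os)"
    "\<And>t. t \<le> r + s \<Longrightarrow> bij_betw \<sigma> (ball_verts ?G [?u] t) (ball_verts ?H [?p] t)"
    using balls_iso_restrict[OF rep_rooted(1)[of x] rep_rooted(1)[of y] sub]
      y[unfolded in_cylinder_iff] by metis
  have iff: "birooted_class ?H ?p (\<sigma> v) \<in> B \<longleftrightarrow> birooted_class ?G ?u v \<in> B"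
    if v: "v \<in> ball_verts ?G [?u] r" for v
  proof (rule B(2))
    have "\<sigma> v \<in> ball_verts ?H [?p] r"
      using \<sigma>(3)[of r] v by (auto simp: bij_betw_def)
    then have "v \<in> verts ?G" "\<sigma> v \<in> verts ?H" using v ball_verts_subset by blast+
    moreover have "balls_iso s ?G [?u, v] ?H [?p, \<sigma> v]"
      using \<sigma>(2)[of "[?u, v]" r s] v \<sigma>(1) roots_in_ball_verts[OF sub, of r] by auto
    ultimately show "birooted_class ?H ?p (\<sigma> v) \<in> birooted_part s (birooted_class ?G ?u v)"
      using rep_rooted by (simp add: birooted_class_part birooted_class_in_bicylinder_iff)
  qed
  have "bij_betw \<sigma> {v \<in> ball_verts ?G [?u] r. birooted_class ?G ?u v \<in> B}
      {v \<in> ball_verts ?H [?p] r. birooted_class ?H ?p v \<in> B}"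
    using \<sigma>(3)[of r] iff by (auto simp: bij_betw_def inj_on_def image_iff) force
  then show ?thesis
    using B(1) by (simp add: emeasure_root_kernel bij_betw_same_card)
qed

lemma measurable_root_kernel:
  assumes "B \<in> sets borel"
  shows "(\<lambda>x. emeasure (root_kernel r x) B) \<in> borel_measurable borel"
proof -
  let ?E = "insert {} {birooted_part s z | s z. True}"
  have sets: "sets borel = sigma_sets UNIV ?E"
    using arg_cong[OF birooted.borel_eq, of sets] by simp
  have const: "(\<lambda>x. emeasure (root_kernel r x) A) \<in> borel_measurable borel"
    if "A \<in> sets borel" "\<And>z w. w \<in> birooted_part s z \<Longrightarrow> w \<in> A \<longleftrightarrow> z \<in> A" for A s
    by (rule rooted.measurable_of_constant_on_classes[of "r + s"])
      (use root_kernel_constant[OF that] in auto)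
  have space: "space (root_kernel r x) = UNIV" "sets (root_kernel r x) = sets borel" for x
    by (simp_all add: root_kernel_def)
  have "?E \<subseteq> Pow UNIV" by simp
  from birooted.Int_stable_classes this assms[unfolded sets] show ?thesis
  proof (induction rule: sigma_sets_induct_disjoint)
    case (basic A)
    then consider "A = {}" | s z where "A = birooted_part s z" by blast
    then show ?case
    proof cases
      case 2
      show ?thesis
      proof (rule const)
        show "A \<in> sets borel" using 2 birooted.open_class by auto
        show "w \<in> A \<longleftrightarrow> z' \<in> A" if "w \<in> birooted_part s z'" for w z'
          using that 2 birooted.eq birooted.self by metis
      qed
    qed simp
  next
    case (compl A)
    have "emeasure (root_kernel r x) (UNIV - A) =
        emeasure (root_kernel r x) UNIV - emeasure (root_kernel r x) A" for x
      using emeasure_compl[of A "root_kernel r x"] compl(1)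
      by (simp add: space sets emeasure_root_kernel ennreal_of_nat_neq_top)
    moreover have "(\<lambda>x. emeasure (root_kernel r x) UNIV) \<in> borel_measurable borel"
      by (rule const[of _ 0]) auto
    ultimately show ?case using compl by simp
  next
    case (union A)
    have "emeasure (root_kernel r x) (\<Union>i. A i) = (\<Sum>i. emeasure (root_kernel r x) (A i))" for x
      using union by (intro suminf_emeasure[symmetric]) (auto simp: space sets)
    then show ?case using union by simp
  qed simp
qed

text \<open>Connectedness: every vertex is at finite distance from the root.\<close>

lemma UN_ball_verts:
  assumes "network G" "u \<in> verts G"
  shows "(\<Union>r. ball_verts G [u] r) = verts G"
proof
  show "verts G \<subseteq> (\<Union>r. ball_verts G [u] r)"
  proof
    fix v assume v: "v \<in> verts G"
    then have "(u, v) \<in> (adj G)\<^sup>*" using assms by (simp add: network_def)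
    then obtain k where "(u, v) \<in> adj G ^^ k" by (auto simp: rtrancl_power)
    then show "v \<in> (\<Union>r. ball_verts G [u] r)" using v by (auto simp: ball_verts_def)
  qed
qed (auto simp: ball_verts_def)

text \<open>The sum is the integral of \<open>g\<close> against the image \<open>?K x\<close> of
  counting measure. On a Borel set this image is the increasing limit of the finite kernels
  \<open>root_kernel r x\<close>; measurability passes from indicators to \<open>g\<close> by
  linearity and monotone limits.\<close>

lemma measurable_vertex_sum:
  fixes g :: "birooted_network \<Rightarrow> ennreal"
  assumes g: "g \<in> borel_measurable borel"
  shows "(\<lambda>x. \<integral>\<^sup>+u. g (birooted_class (net_of x) (root_of x) u) \<partial>count_space (verts (net_of x)))
    \<in> borel_measurable borel"
proof -
  let ?K = "\<lambda>x. distr (count_space (verts (net_of x))) borel (birooted_class (net_of x) (root_of x))"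
  have K: "emeasure (?K x) B = (SUP r. emeasure (root_kernel r x) B)" if B: "B \<in> sets borel" for x B
  proof -
    let ?V = "verts (net_of x)" and ?b = "ball_verts (net_of x) [root_of x]"
    let ?A = "\<lambda>r. {u \<in> ?b r. birooted_class (net_of x) (root_of x) u \<in> B}"
    have fin: "finite (?b r)" for r
      using rep_rooted by (intro finite_ball_verts) auto
    have sub: "?A r \<subseteq> ?V" for r using ball_verts_subset by blast
    have "emeasure (?K x) B = emeasure (count_space ?V) (\<Union>r. ?A r)"
      using B UN_ball_verts[OF rep_rooted(1,2)[of x]]
      by (subst emeasure_distr) (auto intro!: arg_cong[of _ _ "emeasure (count_space ?V)"])
    also have "\<dots> = (SUP r. emeasure (count_space ?V) (?A r))"
      using sub ball_verts_mono[of _ _ "net_of x" "[root_of x]"]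
      by (intro SUP_emeasure_incseq[symmetric]) (auto simp: incseq_def, blast)
    also have "\<dots> = (SUP r. emeasure (root_kernel r x) B)"
      using B fin sub by (simp add: emeasure_root_kernel emeasure_count_space)
    finally show ?thesis .
  qed
  have "(\<lambda>x. \<integral>\<^sup>+z. g z \<partial>?K x) \<in> borel_measurable borel"
    using g
  proof induction
    case (cong f h)
    then show ?case by simp
  next
    case (set A)
    then show ?case
      using measurable_root_kernel[OF set] by (simp add: K)
  next
    case (mult u c)
    then have "(\<integral>\<^sup>+z. c * u z \<partial>?K x) = c * (\<integral>\<^sup>+z. u z \<partial>?K x)" for x
      by (intro nn_integral_cmult) simp
    then show ?case using mult by simp
  next
    case (add u v)
    then have "(\<integral>\<^sup>+z. v z + u z \<partial>?K x) = (\<integral>\<^sup>+z. v z \<partial>?K x) + (\<integral>\<^sup>+z. u z \<partial>?K x)" for x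
      by (intro nn_integral_add) simp_all
    then show ?case using add by simp
  next
    case (seq U)
    have "(\<integral>\<^sup>+z. (SUP i. U i) z \<partial>?K x) = (SUP i. \<integral>\<^sup>+z. U i z \<partial>?K x)" for x
      unfolding SUP_apply using seq by (intro nn_integral_monotone_convergence_SUP) simp_all
    then show ?case using seq by simp
  qed
  then show ?thesis
    using g by (simp add: nn_integral_distr)
qed

lemma measurable_vertex_sum_swap:
  fixes g :: "birooted_network \<Rightarrow> ennreal"
  assumes [measurable]: "g \<in> borel_measurable borel"
  shows "(\<lambda>x. \<integral>\<^sup>+u. g (birooted_class (net_of x) u (root_of x)) \<partial>count_space (verts (net_of x)))
    \<in> borel_measurable borel"
proof -
  have "(\<integral>\<^sup>+u. g (birooted_class (net_of x) u (root_of x)) \<partial>count_space (verts (net_of x))) =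
      (\<integral>\<^sup>+u. g (swap_roots (birooted_class (net_of x) (root_of x) u)) \<partial>count_space (verts (net_of x)))" for x
    using rep_rooted by (intro nn_integral_cong) (simp add: swap_roots_class)
  moreover have "(\<lambda>z. g (swap_roots z)) \<in> borel_measurable borel" by measurable
  ultimately show ?thesis using measurable_vertex_sum by simp
qed

lemma nn_integral_count_space_single:
  fixes h :: "nat \<Rightarrow> ennreal"
  assumes "a \<in> V"
  shows "(\<integral>\<^sup>+u. h u * indicator {a} u \<partial>count_space V) = h a"
  using assms by (subst nn_integral_indicator_singleton) auto

section \<open>Weak limits and unimodularity\<close>

text \<open>Cylinders are clopen, so their indicators are admissible test functions.\<close>

lemma weak_limit_unique:
  fixes Q Q' :: "rooted_network measure"
  assumes Q: "prob_space Q" "sets Q = sets borel" "weak_limit \<mu> Q"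
    and Q': "prob_space Q'" "sets Q' = sets borel" "weak_limit \<mu> Q'"
  shows "Q = Q'"
proof -
  interpret Q: prob_space Q by fact
  interpret Q': prob_space Q' by fact
  let ?E = "insert {} {rooted_part r x | r x. True}"
  have sets: "sets borel = sigma_sets UNIV ?E"
    using arg_cong[OF rooted.borel_eq, of sets] by simp
  have space: "space Q = UNIV" "space Q' = UNIV"
    using sets_eq_imp_space_eq[OF Q(2)] sets_eq_imp_space_eq[OF Q'(2)] by auto
  have part: "emeasure Q (rooted_part r x) = emeasure Q' (rooted_part r x)" for r x
  proof -
    let ?h = "indicator (rooted_part r x) :: rooted_network \<Rightarrow> real"
    have "continuous_on UNIV ?h"
      unfolding continuous_on_open_vimage[OF open_UNIV]
    proof (intro allI impI)
      fix B :: "real set"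
      have "?h -` B = (if 1 \<in> B then rooted_part r x else {}) \<union> (if 0 \<in> B then - rooted_part r x else {})"
        by (auto simp: indicator_def of_bool_def split: if_splits)
      then show "open (?h -` B \<inter> UNIV)"
        using rooted.open_class rooted.closed_class by auto
    qed
    moreover have "bounded (range ?h)"
      by (rule boundedI[of _ 1]) (auto simp: indicator_def)
    ultimately have "(\<lambda>n. \<integral>x. ?h x \<partial>\<mu> n) \<longlonglongrightarrow> (\<integral>x. ?h x \<partial>Q)"
      "(\<lambda>n. \<integral>x. ?h x \<partial>\<mu> n) \<longlonglongrightarrow> (\<integral>x. ?h x \<partial>Q')"
      using Q(3) Q'(3) unfolding weak_limit_def by blast+
    then have "(\<integral>x. ?h x \<partial>Q) = (\<integral>x. ?h x \<partial>Q')"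
      by (rule LIMSEQ_unique)
    moreover have "rooted_part r x \<in> sets borel" using rooted.open_class by simp
    ultimately show ?thesis
      using Q(2) Q'(2) by (simp add: Q.emeasure_eq_measure Q'.emeasure_eq_measure space)
  qed
  \<comment> \<open>The level 0 classes are the countable cover, of finite measure, that the
    uniqueness theorem for measures asks for.\<close>
  have countable: "countable (range (\<lambda>x. rooted_part 0 x))"
    by (rule countable_subset[OF _ rooted.countable_classes]) auto
  show ?thesis
  proof (rule measure_eqI_generator_eq_countable[OF rooted.Int_stable_classes, where \<Omega> = UNIV])
    show "emeasure Q X = emeasure Q' X" if "X \<in> ?E" for X
      using that part by auto
    show "range (\<lambda>x. rooted_part 0 x) \<subseteq> ?E" by auto
    show "\<Union> (range (\<lambda>x. rooted_part 0 x)) = UNIV" using rooted.self by blast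
  qed (use sets Q(2) Q'(2) countable in auto)
qed

text \<open>The bound on a test function is an integrable dominating constant, \<open>M\<close>
  being a probability measure.\<close>

lemma weak_limit_of_AE_limit:
  fixes Y :: "nat \<Rightarrow> 'w \<Rightarrow> 'a::topological_space"
  assumes M: "prob_space M" and Y: "\<And>n. Y n \<in> borel_measurable M" "Z \<in> borel_measurable M"
    and lim: "AE \<omega> in M. (\<lambda>n. Y n \<omega>) \<longlonglongrightarrow> Z \<omega>"
  shows "weak_limit (\<lambda>n. distr M borel (Y n)) (distr M borel Z)"
  unfolding weak_limit_def
proof (intro allI impI, elim conjE)
  fix h :: "'a \<Rightarrow> real" assume cont: "continuous_on UNIV h" and "bounded (range h)"
  then obtain B where B: "\<And>x. \<bar>h x\<bar> \<le> B" by (auto simp: bounded_iff)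
  interpret prob_space M by fact
  note [measurable] = Y borel_measurable_continuous_onI[OF cont]
  have "(\<lambda>n. \<integral>\<omega>. h (Y n \<omega>) \<partial>M) \<longlonglongrightarrow> (\<integral>\<omega>. h (Z \<omega>) \<partial>M)"
  proof (rule integral_dominated_convergence[where w = "\<lambda>_. B"])
    show "AE \<omega> in M. (\<lambda>n. h (Y n \<omega>)) \<longlonglongrightarrow> h (Z \<omega>)"
      using lim by eventually_elim (rule continuous_on_tendsto_compose[OF cont], auto)
  qed (use B in auto)
  then show "(\<lambda>n. \<integral>x. h x \<partial>distr M borel (Y n)) \<longlonglongrightarrow> (\<integral>x. h x \<partial>distr M borel Z)"
    by (simp add: integral_distr)
qed

text \<open>The definition of \<open>unimodular\<close> tests real-valued functions only, while
  \<open>d_n\<close> may be infinite. Finite-valued simple functions increasing to \<open>g\<close>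
  bridge the gap, with monotone convergence for the inner and the outer integral.\<close>

lemma unimodular_ennreal:
  fixes g :: "birooted_network \<Rightarrow> ennreal"
  assumes P: "sets P = sets borel" "unimodular P" and g: "g \<in> borel_measurable borel"
  shows "(\<integral>\<^sup>+x. (\<integral>\<^sup>+u. g (birooted_class (net_of x) (root_of x) u) \<partial>count_space (verts (net_of x))) \<partial>P) =
    (\<integral>\<^sup>+x. (\<integral>\<^sup>+u. g (birooted_class (net_of x) u (root_of x)) \<partial>count_space (verts (net_of x))) \<partial>P)"
proof -
  obtain U where U: "\<And>i. simple_function borel (U i)" "incseq U"
    "\<And>i z. U i z < top" "\<And>z. (SUP i. U i z) = g z"
    using borel_measurable_implies_simple_function_sequence'[OF g] by metis
  have [measurable]: "U i \<in> borel_measurable borel" for i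
    using U(1) by (rule borel_measurable_simple_function)
  have eq: "(\<integral>\<^sup>+x. (\<integral>\<^sup>+u. U i (birooted_class (net_of x) (root_of x) u) \<partial>count_space (verts (net_of x))) \<partial>P) =
    (\<integral>\<^sup>+x. (\<integral>\<^sup>+u. U i (birooted_class (net_of x) u (root_of x)) \<partial>count_space (verts (net_of x))) \<partial>P)" for i
  proof -
    have "(\<lambda>z. enn2real (U i z)) \<in> borel_measurable borel" by measurable
    moreover have "ennreal (enn2real (U i z)) = U i z" for z
      using U(3)[of i z] by simp
    ultimately show ?thesis
      using P(2)[unfolded unimodular_def, rule_format, of "\<lambda>z. enn2real (U i z)"] by simp
  qed
  \<comment> \<open>Here \<open>c x u\<close> stands for either order of the two roots.\<close>
  have SUP: "(\<integral>\<^sup>+x. (\<integral>\<^sup>+u. g (c x u) \<partial>count_space (verts (net_of x))) \<partial>P) =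
      (SUP i. \<integral>\<^sup>+x. (\<integral>\<^sup>+u. U i (c x u) \<partial>count_space (verts (net_of x))) \<partial>P)"
    if c: "\<And>i. (\<lambda>x. \<integral>\<^sup>+u. U i (c x u) \<partial>count_space (verts (net_of x))) \<in> borel_measurable borel" for c
  proof -
    have "(\<integral>\<^sup>+u. g (c x u) \<partial>count_space (verts (net_of x))) =
        (SUP i. \<integral>\<^sup>+u. U i (c x u) \<partial>count_space (verts (net_of x)))" for x
      unfolding U(4)[symmetric]
      by (rule nn_integral_monotone_convergence_SUP) (use U(2) in \<open>auto simp: incseq_def le_fun_def\<close>)
    moreover have "incseq (\<lambda>i x. \<integral>\<^sup>+u. U i (c x u) \<partial>count_space (verts (net_of x)))"
      using U(2) by (auto simp: incseq_def le_fun_def intro!: nn_integral_mono)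
    ultimately show ?thesis
      using c by (simp add: nn_integral_monotone_convergence_SUP measurable_cong_sets[OF P(1) refl])
  qed
  show ?thesis
    by (simp add: SUP eq measurable_vertex_sum measurable_vertex_sum_swap)
qed

section \<open>Vertex-shifts\<close>

text \<open>This is the set that \<open>vertex_shift\<close> requires to be Borel.\<close>

definition shift_graph :: "(multigraph \<Rightarrow> nat \<Rightarrow> nat) \<Rightarrow> birooted_network set" where
  "shift_graph f = {birooted_class G u v | G u v. network G \<and> u \<in> verts G \<and> v \<in> verts G \<and> f G u = v}"

text \<open>A junk value if no iterate of the root is a trap.\<close>

definition settle :: "(multigraph \<Rightarrow> nat \<Rightarrow> nat) \<Rightarrow> rooted_network \<Rightarrow> rooted_network" where
  "settle f x = move_root f (LEAST n. trap f (move_root f n x)) x"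

context
  fixes f :: "multigraph \<Rightarrow> nat \<Rightarrow> nat"
  assumes f: "vertex_shift f"
begin

lemma shift_in_verts:
  assumes "network G" "u \<in> verts G"
  shows "f G u \<in> verts G" "(f G ^^ n) u \<in> verts G"
  using vertex_shift_funpow(1)[OF f assms(1) assms(1) graph_iso_id assms(2)]
    vertex_shift_funpow(1)[OF f assms(1) assms(1) graph_iso_id assms(2), of 1] by simp_all

text \<open>Equivariance of \<open>f\<close> makes the condition independent of the
  representative.\<close>

lemma shift_graph_iff:
  assumes "network G" "u \<in> verts G" "v \<in> verts G"
  shows "birooted_class G u v \<in> shift_graph f \<longleftrightarrow> f G u = v"
proof
  assume "birooted_class G u v \<in> shift_graph f"
  then obtain H p where H: "network H" "p \<in> verts H" "f H p \<in> verts H"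
    "birooted_class H p (f H p) = birooted_class G u v"
    unfolding shift_graph_def by (auto dest: sym)
  then obtain \<sigma> \<tau> where "graph_iso \<sigma> \<tau> H G" "\<sigma> p = u" "\<sigma> (f H p) = v"
    using birooted_class_eq_iff[OF H(1-3) assms] by (auto simp: rooted_iso_def)
  then show "f G u = v"
    using vertex_shift_funpow(2)[OF f H(1) assms(1) _ H(2), of \<sigma> \<tau> 1] by simp
qed (use assms in \<open>auto simp: shift_graph_def\<close>)

lemma sets_shift_graph [measurable]: "shift_graph f \<in> sets borel"
  using f by (simp add: vertex_shift_def shift_graph_def)

section \<open>Iterates of the shift and settling at a trap\<close>

lemma move_root_0 [simp]: "move_root f 0 x = x"
  by (simp add: move_root_def rep_rooted(3))

text \<open>The moved network may have another chosen representative;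
  \<open>move_root_rooted_class\<close> allows continuing in the graph of \<open>x\<close>.\<close>

lemma move_root_Suc: "move_root f (Suc n) x = move_root f (Suc 0) (move_root f n x)"
  unfolding move_root_def[of f n x] move_root_def[of f "Suc n" x]
  by (subst move_root_rooted_class[OF f]) (simp_all add: rep_rooted(1,2) shift_in_verts)

text \<open>Only the term at the image of the root survives. In this form one step of the shift is
  accessible both to \<open>measurable_vertex_sum\<close> and to mass transport.\<close>

lemma move_root_one_vertex_sum:
  fixes \<psi> :: "rooted_network \<Rightarrow> ennreal"
  shows "(\<integral>\<^sup>+u. \<psi> (forget1 (birooted_class (net_of x) (root_of x) u)) *
      indicator (shift_graph f) (birooted_class (net_of x) (root_of x) u) \<partial>count_space (verts (net_of x))) =
    \<psi> (move_root f (Suc 0) x)"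
proof -
  let ?G = "net_of x" and ?o = "root_of x"
  have "(\<integral>\<^sup>+u. \<psi> (forget1 (birooted_class ?G ?o u)) *
      indicator (shift_graph f) (birooted_class ?G ?o u) \<partial>count_space (verts ?G)) =
    (\<integral>\<^sup>+u. \<psi> (rooted_class ?G u) * indicator {f ?G ?o} u \<partial>count_space (verts ?G))"
    using rep_rooted(1,2)
    by (intro nn_integral_cong) (auto simp: forget1_class shift_graph_iff indicator_def)
  also have "\<dots> = \<psi> (rooted_class ?G (f ?G ?o))"
    by (rule nn_integral_count_space_single) (simp add: shift_in_verts rep_rooted(1,2))
  finally show ?thesis by (simp add: move_root_def)
qed

lemma measurable_move_root_one: "move_root f (Suc 0) \<in> borel_measurable borel"
proof (rule measurableI)
  fix A :: "rooted_network set" assume [measurable]: "A \<in> sets borel"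
  have "(\<lambda>x. indicator A (move_root f (Suc 0) x) :: ennreal) \<in> borel_measurable borel"
    unfolding move_root_one_vertex_sum[symmetric] by (intro measurable_vertex_sum) measurable
  moreover have "(\<lambda>x. indicator A (move_root f (Suc 0) x) :: ennreal) =
      indicator (move_root f (Suc 0) -` A)" by (auto simp: indicator_def)
  ultimately show "move_root f (Suc 0) -` A \<inter> space borel \<in> sets borel"
    by (simp add: borel_measurable_indicator_iff)
qed simp

lemma measurable_move_root [measurable]: "move_root f n \<in> borel_measurable borel"
proof (induction n)
  case 0
  then show ?case by (simp add: move_root_0[abs_def])
next
  case (Suc n)
  have "move_root f (Suc n) = (\<lambda>x. move_root f (Suc 0) (move_root f n x))"
    by (rule ext) (rule move_root_Suc)
  then show ?case
    using measurable_compose[OF Suc measurable_move_root_one] by simp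
qed

lemma trap_iff_double_root: "trap f x \<longleftrightarrow> double_root x \<in> shift_graph f"
  using rep_rooted(1,2) by (simp add: trap_def double_root_def shift_graph_iff)

lemma measurable_trap [measurable]: "Measurable.pred borel (trap f)"
proof -
  have "Measurable.pred borel (\<lambda>x. double_root x \<in> shift_graph f)" by measurable
  then show ?thesis by (simp add: trap_iff_double_root[abs_def])
qed

lemma measurable_settle [measurable]: "settle f \<in> borel_measurable borel"
proof -
  have "(\<lambda>x. LEAST n. trap f (move_root f n x)) \<in> measurable borel (count_space UNIV)"
    by measurable
  then show ?thesis
    unfolding settle_def[abs_def]
    by (rule measurable_compose_countable[where f = "move_root f", OF measurable_move_root])
qed

lemma trap_move_root_iff:
  "trap f (move_root f n x) \<longleftrightarrow>
    f (net_of x) ((f (net_of x) ^^ n) (root_of x)) = (f (net_of x) ^^ n) (root_of x)"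
  unfolding move_root_def
  by (rule trap_rooted_class[OF f]) (simp_all add: rep_rooted(1,2) shift_in_verts)

lemma move_root_after_trap:
  assumes "trap f (move_root f n x)" "n \<le> m"
  shows "move_root f m x = move_root f n x"
proof -
  let ?F = "f (net_of x)"
  have "(?F ^^ (n + k)) (root_of x) = (?F ^^ n) (root_of x)" for k
    using assms(1) by (induction k) (simp_all add: trap_move_root_iff)
  from this[of "m - n"] show ?thesis using assms(2) by (simp add: move_root_def)
qed

text \<open>The least time at which a trap is reached is at most \<open>n\<close>, and the orbit
  rests from then on.\<close>

lemma settle_eq:
  assumes "trap f (move_root f n x)"
  shows "settle f x = move_root f n x"
proof -
  let ?k = "LEAST n. trap f (move_root f n x)"
  have "trap f (move_root f ?k x)" "?k \<le> n"
    using assms by (rule LeastI, rule Least_le)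
  then show ?thesis
    unfolding settle_def by (rule move_root_after_trap[symmetric])
qed

text \<open>One step that leaves the orbit in place fixes it forever.\<close>

lemma eventually_fixed_iff: "eventually_fixed f x \<longleftrightarrow> (\<exists>n. trap f (move_root f n x))"
proof
  assume "eventually_fixed f x"
  then show "\<exists>n. trap f (move_root f n x)"
    by (auto simp: eventually_fixed_def trap_move_root_iff)
next
  let ?F = "f (net_of x)"
  assume "\<exists>n. trap f (move_root f n x)"
  then obtain n where n: "?F ((?F ^^ n) (root_of x)) = (?F ^^ n) (root_of x)"
    by (auto simp: trap_move_root_iff)
  have "(?F ^^ (n + k)) (root_of x) = (?F ^^ n) (root_of x)" for k
    by (induction k) (simp_all add: n)
  then have "(?F ^^ m) (root_of x) = (?F ^^ n) (root_of x)" if "n \<le> m" for m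
    using that by (metis le_add_diff_inverse)
  then show "eventually_fixed f x"
    unfolding eventually_fixed_def by (metis le_add1 le_trans)
qed

lemma tendsto_settle:
  assumes "eventually_fixed f x"
  shows "(\<lambda>n. move_root f n x) \<longlonglongrightarrow> settle f x"
proof -
  obtain n where n: "trap f (move_root f n x)"
    using assms by (auto simp: eventually_fixed_iff)
  have "\<forall>\<^sub>F m in sequentially. move_root f m x = settle f x"
    unfolding eventually_sequentially settle_eq[OF n] using move_root_after_trap[OF n] by blast
  then show ?thesis by (rule tendsto_eventually)
qed

section \<open>Counting preimages and mass transport\<close>

lemma d_n_0: "d_n f 0 x = 1"
proof -
  have "{v \<in> verts (net_of x). v = root_of x} = {root_of x}"
    using rep_rooted(2) by auto
  then show ?thesis
    using rep_rooted(2)[of x] by (simp add: d_n_def)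
qed

text \<open>The vertices that reach the root in \<open>n + 1\<close> steps are sorted by their
  position \<open>u\<close> after \<open>n\<close> steps. The root is the second argument, so the
  sum is the mass received by the root.\<close>

lemma d_n_Suc:
  "d_n f (Suc n) x = (\<integral>\<^sup>+u. d_n f n (forget2 (birooted_class (net_of x) u (root_of x))) *
    indicator (shift_graph f) (birooted_class (net_of x) u (root_of x)) \<partial>count_space (verts (net_of x)))"
proof -
  let ?G = "net_of x" and ?o = "root_of x"
  let ?V = "verts ?G" and ?F = "f ?G"
  let ?I = "{u \<in> ?V. ?F u = ?o}" and ?A = "\<lambda>u. {v \<in> ?V. (?F ^^ n) v = u}"
  have "{v \<in> ?V. (?F ^^ Suc n) v = ?o} = (\<Union>u \<in> ?I. ?A u)"
    using shift_in_verts[OF rep_rooted(1)[of x]] by auto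
  then have "d_n f (Suc n) x = (\<integral>\<^sup>+u. emeasure (count_space ?V) (?A u) \<partial>count_space ?I)"
    unfolding d_n_def by (simp only:) (intro emeasure_UN_countable, auto simp: disjoint_family_on_def)
  also have "\<dots> = (\<integral>\<^sup>+u. d_n f n (rooted_class ?G u) \<partial>count_space ?I)"
    using rep_rooted(1)[of x] by (intro nn_integral_cong) (simp add: d_n_rooted_class[OF f])
  also have "\<dots> = (\<integral>\<^sup>+u. d_n f n (rooted_class ?G u) * indicator ?I u \<partial>count_space ?V)"
    by (subst (1 2) nn_integral_count_space_indicator)
      (auto intro!: nn_integral_cong simp: indicator_def)
  also have "\<dots> = (\<integral>\<^sup>+u. d_n f n (forget2 (birooted_class ?G u ?o)) *
      indicator (shift_graph f) (birooted_class ?G u ?o) \<partial>count_space ?V)"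
    using rep_rooted(1,2)
    by (intro nn_integral_cong) (auto simp: forget2_class shift_graph_iff indicator_def)
  finally show ?thesis .
qed

lemma measurable_d_n [measurable]: "d_n f n \<in> borel_measurable borel"
proof (induction n)
  case 0
  then show ?case by (simp add: d_n_0[abs_def])
next
  case (Suc n)
  note [measurable] = Suc
  show ?case
    unfolding d_n_Suc[abs_def] by (intro measurable_vertex_sum_swap) measurable
qed

text \<open>A vertex whose orbit is at the trap after \<open>n\<close> steps is still there one step
  later.\<close>

lemma incseq_d_n:
  assumes "trap f x"
  shows "incseq (\<lambda>n. d_n f n x)"
proof (rule incseq_SucI)
  fix n
  have "{v \<in> verts (net_of x). (f (net_of x) ^^ n) v = root_of x}
      \<subseteq> {v \<in> verts (net_of x). (f (net_of x) ^^ Suc n) v = root_of x}"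
    using assms by (auto simp: trap_def)
  then show "d_n f n x \<le> d_n f (Suc n) x"
    unfolding d_n_def by (rule emeasure_mono) auto
qed

lemma mass_transport_move_root:
  fixes \<psi> :: "rooted_network \<Rightarrow> ennreal"
  assumes P: "sets P = sets borel" "unimodular P" and "\<psi> \<in> borel_measurable borel"
  shows "(\<integral>\<^sup>+x. \<psi> (move_root f n x) \<partial>P) = (\<integral>\<^sup>+x. \<psi> x * d_n f n x \<partial>P)"
  using assms(3)
proof (induction n arbitrary: \<psi>)
  case 0
  then show ?case by (simp add: d_n_0)
next
  case (Suc n)
  note [measurable] = Suc.prems
  \<comment> \<open>Each vertex \<open>o\<close> sends mass \<open>d\<^sub>n(o) \<psi>(f(o))\<close>
    to \<open>f(o)\<close>. The mass sent by the root is the left side of the claim after the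
    induction hypothesis; by \<open>d_n_Suc\<close> the mass it receives is
    \<open>\<psi>(o) d\<^sub>n\<^sub>+\<^sub>1(o)\<close>.\<close>
  define g where "g z = d_n f n (forget2 z) * \<psi> (forget1 z) * indicator (shift_graph f) z" for z
  have [measurable]: "g \<in> borel_measurable borel" unfolding g_def by measurable
  \<comment> \<open>The induction hypothesis is used for \<psi> composed with one step, hence the
    generalisation over \<psi>.\<close>
  have "(\<integral>\<^sup>+x. \<psi> (move_root f (Suc n) x) \<partial>P) = (\<integral>\<^sup>+x. \<psi> (move_root f (Suc 0) x) * d_n f n x \<partial>P)"
    unfolding move_root_Suc[of n]
    by (rule Suc.IH) (use measurable_compose[OF measurable_move_root Suc.prems] in simp)
  also have "\<dots> = (\<integral>\<^sup>+x. (\<integral>\<^sup>+u. g (birooted_class (net_of x) (root_of x) u) \<partial>count_space (verts (net_of x))) \<partial>P)"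
  proof (intro nn_integral_cong)
    fix x
    have "(\<integral>\<^sup>+u. g (birooted_class (net_of x) (root_of x) u) \<partial>count_space (verts (net_of x))) =
      (\<integral>\<^sup>+u. d_n f n x * (\<psi> (forget1 (birooted_class (net_of x) (root_of x) u)) *
      indicator (shift_graph f) (birooted_class (net_of x) (root_of x) u)) \<partial>count_space (verts (net_of x)))"
      using rep_rooted by (intro nn_integral_cong) (simp add: g_def forget2_class mult.assoc)
    also have "\<dots> = d_n f n x * \<psi> (move_root f (Suc 0) x)"
      by (simp add: nn_integral_cmult move_root_one_vertex_sum)
    finally show "\<psi> (move_root f (Suc 0) x) * d_n f n x =
      (\<integral>\<^sup>+u. g (birooted_class (net_of x) (root_of x) u) \<partial>count_space (verts (net_of x)))"
      by (simp add: mult.commute)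
  qed
  also have "\<dots> = (\<integral>\<^sup>+x. (\<integral>\<^sup>+u. g (birooted_class (net_of x) u (root_of x)) \<partial>count_space (verts (net_of x))) \<partial>P)"
    by (rule unimodular_ennreal[OF P]) measurable
  also have "\<dots> = (\<integral>\<^sup>+x. \<psi> x * d_n f (Suc n) x \<partial>P)"
  proof (intro nn_integral_cong)
    fix x
    have "(\<integral>\<^sup>+u. g (birooted_class (net_of x) u (root_of x)) \<partial>count_space (verts (net_of x))) =
      (\<integral>\<^sup>+u. \<psi> x * (d_n f n (forget2 (birooted_class (net_of x) u (root_of x))) *
      indicator (shift_graph f) (birooted_class (net_of x) u (root_of x))) \<partial>count_space (verts (net_of x)))"
      using rep_rooted by (intro nn_integral_cong) (simp add: g_def forget1_class mult_ac)
    then show "(\<integral>\<^sup>+u. g (birooted_class (net_of x) u (root_of x)) \<partial>count_space (verts (net_of x))) =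
        \<psi> x * d_n f (Suc n) x"
      by (simp add: nn_integral_cmult d_n_Suc)
  qed
  finally show ?case .
qed

text \<open>The density is written with a supremum, which is measurable and suits monotone
  convergence; at traps it agrees with \<open>d_infty\<close>.\<close>

lemma density_d_n_SUP:
  assumes P: "sets P = sets borel" "unimodular P" and fixed: "AE x in P. eventually_fixed f x"
  shows "density P (\<lambda>x. (SUP n. d_n f n x) * indicator {x. trap f x} x) = distr P borel (settle f)"
proof (rule measure_eqI)
  have space: "space P = UNIV" using sets_eq_imp_space_eq[OF P(1)] by simp
  note mP = measurable_cong_sets[OF P(1) refl]
  fix A assume "A \<in> sets (density P (\<lambda>x. (SUP n. d_n f n x) * indicator {x. trap f x} x))"
  then have A: "A \<in> sets borel" using P(1) by simp
  let ?B = "A \<inter> {x. trap f x}"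
  have [measurable]: "?B \<in> sets borel" "A \<in> sets borel" using A by auto
  have "emeasure (density P (\<lambda>x. (SUP n. d_n f n x) * indicator {x. trap f x} x)) A =
      (\<integral>\<^sup>+x. (SUP n. d_n f n x) * indicator {x. trap f x} x * indicator A x \<partial>P)"
    using A P(1) by (intro emeasure_density) (simp_all add: mP)
  also have "\<dots> = (\<integral>\<^sup>+x. (SUP n. indicator ?B x * d_n f n x) \<partial>P)"
    by (intro nn_integral_cong) (auto simp: indicator_def SUP_mult_left_ennreal)
  also have "\<dots> = (SUP n. \<integral>\<^sup>+x. indicator ?B x * d_n f n x \<partial>P)"
  proof (rule nn_integral_monotone_convergence_SUP)
    show "incseq (\<lambda>n x. indicator ?B x * d_n f n x)"
      using incseq_d_n by (auto simp: incseq_def le_fun_def indicator_def)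
  qed (simp add: mP)
  also have "\<dots> = (SUP n. \<integral>\<^sup>+x. indicator ?B (move_root f n x) \<partial>P)"
    by (simp add: mass_transport_move_root[OF P])
  also have "\<dots> = (\<integral>\<^sup>+x. (SUP n. indicator ?B (move_root f n x)) \<partial>P)"
  proof (rule nn_integral_monotone_convergence_SUP[symmetric])
    show "incseq (\<lambda>n x. indicator ?B (move_root f n x) :: ennreal)"
    proof (intro incseq_SucI le_funI)
      fix n x
      show "(indicator ?B (move_root f n x) :: ennreal) \<le> indicator ?B (move_root f (Suc n) x)"
        using move_root_after_trap[of n x "Suc n"] by (cases "trap f (move_root f n x)") auto
    qed
  qed (simp add: mP)
  \<comment> \<open>Any visit to \<open>?B\<close> is at a trap, hence at the settled network;
    conversely an eventually fixed orbit reaches a trap, where the indicators of \<open>?B\<close>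
    and \<open>A\<close> agree.\<close>
  also have "\<dots> = (\<integral>\<^sup>+x. indicator A (settle f x) \<partial>P)"
  proof (rule nn_integral_cong_AE)
    show "AE x in P. (SUP n. indicator ?B (move_root f n x)) = (indicator A (settle f x) :: ennreal)"
      using fixed
    proof eventually_elim
      case (elim x)
      then obtain n where n: "trap f (move_root f n x)" by (auto simp: eventually_fixed_iff)
      show ?case
      proof (rule antisym)
        show "(SUP n. indicator ?B (move_root f n x)) \<le> (indicator A (settle f x) :: ennreal)"
          by (rule SUP_least) (auto simp: indicator_def settle_eq)
        have "(indicator A (settle f x) :: ennreal) = indicator ?B (move_root f n x)"
          using n by (simp add: settle_eq[OF n] indicator_def)
        also have "\<dots> \<le> (SUP n. indicator ?B (move_root f n x))"
          by (rule SUP_upper) simp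
        finally show "(indicator A (settle f x) :: ennreal) \<le> (SUP n. indicator ?B (move_root f n x))" .
      qed
    qed
  qed
  also have "\<dots> = emeasure (distr P borel (settle f)) A"
  proof -
    have "settle f -` A \<in> sets borel" using measurable_sets[OF measurable_settle A] by simp
    moreover have "(\<lambda>x. indicator A (settle f x) :: ennreal) = indicator (settle f -` A)"
      by (auto simp: indicator_def)
    ultimately show ?thesis
      using A P(1) by (simp add: emeasure_distr mP space)
  qed
  finally show "emeasure (density P (\<lambda>x. (SUP n. d_n f n x) * indicator {x. trap f x} x)) A =
      emeasure (distr P borel (settle f)) A" .
qed (simp add: P(1))

text \<open>Monotonicity at a trap supplies the limit without which \<open>lim\<close> would say
  nothing.\<close>

lemma d_infty_eq_SUP:
  assumes "trap f x"
  shows "(\<lambda>n. d_n f n x) \<longlonglongrightarrow> (SUP n. d_n f n x)" "d_infty f x = (SUP n. d_n f n x)"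
proof -
  show "(\<lambda>n. d_n f n x) \<longlonglongrightarrow> (SUP n. d_n f n x)"
    by (rule LIMSEQ_SUP[OF incseq_d_n[OF assms]])
  then show "d_infty f x = (SUP n. d_n f n x)"
    unfolding d_infty_def by (rule limI)
qed

end

text \<open>The random network is a variable \<open>X\<close> on \<open>M\<close>, so that its
  almost sure limit lives on the same space. Existence of a measurable version is asserted
  separately, which keeps the claim about all versions \<open>Xbar\<close> from being
  vacuous.\<close>

theorem theorem72:
  fixes M :: "'w measure" and X :: "'w \<Rightarrow> rooted_network"
    and P0 :: "rooted_network measure" and f :: "multigraph \<Rightarrow> nat \<Rightarrow> nat"
  assumes "prob_space M" and "X \<in> borel_measurable M" and "P0 = distr M borel X"
    and "vertex_shift f" and "one_periodic f P0"
  shows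
    "(\<exists>Xbar \<in> borel_measurable M. AE \<omega> in M. (\<lambda>n. move_root f n (X \<omega>)) \<longlonglongrightarrow> Xbar \<omega>) \<and>
     (\<exists>!Q. has_f_probability f P0 Q) \<and>
     (\<forall>Xbar \<in> borel_measurable M.
        (AE \<omega> in M. (\<lambda>n. move_root f n (X \<omega>)) \<longlonglongrightarrow> Xbar \<omega>) \<longrightarrow>
        f_probability f P0 = distr M borel Xbar) \<and>
     (unimodular P0 \<longrightarrow>
        absolutely_continuous P0 (f_probability f P0) \<and>
        (AE x in f_probability f P0. \<exists>L. L < \<infinity> \<and> (\<lambda>n. d_n f n x) \<longlonglongrightarrow> L) \<and>
        (AE x in P0. RN_deriv P0 (f_probability f P0) x =
           d_infty f x * indicator {x. trap f x} x))"
proof -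
  note f = assms(4) and P0 = assms(3) and [measurable] = assms(2)
  note [measurable] = measurable_move_root[OF f] measurable_settle[OF f] measurable_trap[OF f]
    measurable_d_n[OF f]
  interpret M: prob_space M by fact
  have fixed: "AE x in P0. eventually_fixed f x"
    using assms(5) by (simp add: one_periodic_def)
  \<comment> \<open>The settled network is a concrete measurable version of the limit.\<close>
  let ?X = "\<lambda>\<omega>. settle f (X \<omega>)"
  have lim: "AE \<omega> in M. (\<lambda>n. move_root f n (X \<omega>)) \<longlonglongrightarrow> ?X \<omega>"
    using AE_distrD[OF assms(2) fixed[unfolded P0]]
    by eventually_elim (rule tendsto_settle[OF f])
  have law: "has_f_probability f P0 (distr M borel Xbar)"
    if Xbar: "Xbar \<in> borel_measurable M" "AE \<omega> in M. (\<lambda>n. move_root f n (X \<omega>)) \<longlonglongrightarrow> Xbar \<omega>" for Xbar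
  proof -
    have "distr P0 borel (move_root f n) = distr M borel (\<lambda>\<omega>. move_root f n (X \<omega>))" for n
      unfolding P0 by (subst distr_distr) (simp_all add: comp_def)
    then show ?thesis
      using weak_limit_of_AE_limit[OF assms(1) _ Xbar] M.prob_space_distr[OF Xbar(1)]
      by (simp add: has_f_probability_def)
  qed
  \<comment> \<open>Uniqueness is what determines the \<open>THE\<close> in
    \<open>f_probability\<close>.\<close>
  have unique: "Q = Q'" if "has_f_probability f P0 Q" "has_f_probability f P0 Q'" for Q Q'
    using that weak_limit_unique unfolding has_f_probability_def by blast
  have prob: "f_probability f P0 = Q" if "has_f_probability f P0 Q" for Q
    unfolding f_probability_def using that unique by blast
  have lawX: "has_f_probability f P0 (distr M borel ?X)"
    by (rule law[OF _ lim]) measurable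
  have unimod: "absolutely_continuous P0 (f_probability f P0) \<and>
      (AE x in f_probability f P0. \<exists>L. L < \<infinity> \<and> (\<lambda>n. d_n f n x) \<longlonglongrightarrow> L) \<and>
      (AE x in P0. RN_deriv P0 (f_probability f P0) x = d_infty f x * indicator {x. trap f x} x)"
    if U: "unimodular P0"
  proof -
    let ?D = "\<lambda>x. (SUP n. d_n f n x) * indicator {x. trap f x} x"
    have sets: "sets P0 = sets borel" by (simp add: P0)
    interpret P: prob_space P0 unfolding P0 by (rule M.prob_space_distr) measurable
    have D: "?D \<in> borel_measurable P0"
      unfolding measurable_cong_sets[OF sets refl] by measurable
    have Q: "density P0 ?D = f_probability f P0"
    proof -
      have "distr P0 borel (settle f) = distr M borel ?X"
        unfolding P0 by (subst distr_distr) (simp_all add: comp_def)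
      then show ?thesis
        using density_d_n_SUP[OF f sets U fixed] prob[OF lawX] by simp
    qed
    \<comment> \<open>The integral of the density is the total mass of a probability measure, so the
      density is finite almost everywhere.\<close>
    have "(\<integral>\<^sup>+x. ?D x \<partial>P0) = emeasure (density P0 ?D) (space P0)"
      using D by (subst emeasure_density) (auto intro!: nn_integral_cong)
    also have "\<dots> = 1"
      using lawX prob[OF lawX] prob_space.emeasure_space_1[of "density P0 ?D"]
      by (simp add: Q has_f_probability_def sets_eq_imp_space_eq[OF sets])
    finally have "AE x in P0. ?D x \<noteq> \<infinity>"
      using D by (intro nn_integral_PInf_AE) auto
    then have "AE x in f_probability f P0. \<exists>L. L < \<infinity> \<and> (\<lambda>n. d_n f n x) \<longlonglongrightarrow> L"
      \<comment> \<open>Only points of positive density matter for \<open>P\<^sub>0\<^sup>f\<close>;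
        they are traps, where the density is the limit of the \<open>d_n\<close>.\<close>
      unfolding Q[symmetric] AE_density[OF D]
    proof eventually_elim
      case (elim x)
      show ?case
      proof
        assume "0 < ?D x"
        then have "trap f x" by (cases "trap f x") auto
        then show "\<exists>L. L < \<infinity> \<and> (\<lambda>n. d_n f n x) \<longlonglongrightarrow> L"
          using elim d_infty_eq_SUP(1)[OF f, of x]
          by (intro exI[of _ "SUP n. d_n f n x"] conjI)
            (simp_all only: less_top infinity_ennreal_def indicator_simps mem_Collect_eq mult_1_right)
      qed
    qed
    moreover have "AE x in P0. ?D x = RN_deriv P0 (f_probability f P0) x"
      by (rule P.RN_deriv_unique[OF D Q])
    then have "AE x in P0. RN_deriv P0 (f_probability f P0) x = d_infty f x * indicator {x. trap f x} x"
      \<comment> \<open>Off the traps both sides vanish, whatever the value of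
        \<open>d_infty\<close> there.\<close>
      by eventually_elim (auto simp: indicator_def d_infty_eq_SUP(2)[OF f] split: if_splits)
    moreover have "absolutely_continuous P0 (f_probability f P0)"
      unfolding Q[symmetric] by (rule absolutely_continuousI_density[OF D])
    ultimately show ?thesis by blast
  qed
  have "\<exists>!Q. has_f_probability f P0 Q"
    using lawX unique by blast
  moreover have "\<exists>Xbar \<in> borel_measurable M. AE \<omega> in M. (\<lambda>n. move_root f n (X \<omega>)) \<longlonglongrightarrow> Xbar \<omega>"
    by (rule bexI[of _ ?X]) (rule lim, measurable)
  ultimately show ?thesis
    using prob law unimod by blast
qed

end
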